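(* Let $\lambda\in\mathbb{C}^*$ and $\beta(y)=\sum_{i\ge0}\beta_iy^i\in\mathbb{C}[y]$, and let $\Omega(\lambda,\beta)=\mathbb{C}[x,y]\oplus\mathbb{C}[s,t]$ be the associated module over the N=1 Heisenberg-Virasoro superalgebra $\mathfrak{g}$. For $g(y)\in\mathbb{C}[y]$ put $R_g=g(y)\mathbb{C}[x,y]\oplus g(t)\mathbb{C}[s,t]$ and $S_g=g(y)\big(x\mathbb{C}[x,y]+y\mathbb{C}[x,y]\big)\oplus g(t)\mathbb{C}[s,t]$, both subspaces of $\Omega(\lambda,\beta)$. Then: (1) If $\beta_0\neq0$, the set $\{R_g\mid g(y)\in\mathbb{C}[y]\}$ exhausts all $\mathfrak{g}$-submodules of $\Omega(\lambda,\beta)$. Moreover, $R_g\subseteq R_{\hat g}$ for any $g(y),\hat g(y)\in\mathbb{C}[y]$ with $\hat g(y)\mid g(y)$. (2) If $\beta_0=0$, the set $\{R_g,S_g\mid g(y)\in\mathbb{C}[y]\}$ exhausts all $\mathfrak{g}$-submodules of $\Omega(\lambda,\beta)$. Moreover, $S_g\subseteq R_g\subseteq R_{\hat g}$ for any $g(y),\hat g(y)\in\mathbb{C}[y]$ with $\hat g(y)\mid g(y)$. (3) For any nonzero $g(y)\in\mathbb{C}[y]$, the quotient $\Omega(\lambda,\beta)/R_g$ is a free $\mathbb{C}[L_0]$-module of rank $2\deg g(y)$. Any maximal submodule of $\Omega(\lambda,\beta)$ is of the form $R_g$ for some $g(y)\in\mathbb{C}[y]$ with $\deg g(y)=1$.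
   Context: All vector spaces are over $\mathbb{C}$; all modules (and submodules) over Lie superalgebras are $\mathbb{Z}_2$-graded. $\mathbb{C}^*$ is the set of nonzero complex numbers. The N=1 Heisenberg-Virasoro superalgebra $\mathfrak{g}$ is the Lie superalgebra with basis $L_m,H_m,C_1,C_2,C_3$ (even, $m\in\mathbb{Z}$) and $G_p,Q_p$ (odd, $p\in\mathbb{Z}+\frac12$), and brackets, for $m,n\in\mathbb{Z}$, $p,q\in\mathbb{Z}+\frac12$, $[L_m,L_n]=(m-n)L_{m+n}+\delta_{m+n,0}\frac{m^3-m}{12}C_1$, $[L_m,H_n]=-nH_{m+n}+\delta_{m+n,0}(m^2+m)C_2$, $[H_m,H_n]=m\delta_{m+n,0}C_3$, $[L_m,G_p]=(\frac m2-p)G_{m+p}$, $[L_m,Q_p]=-(\frac m2+p)Q_{m+p}$, $[H_m,G_p]=mQ_{m+p}$, $[G_p,G_q]=2L_{p+q}+\delta_{p+q,0}\frac{4p^2-1}{12}C_1$, $[G_p,Q_q]=H_{p+q}+(2p+1)\delta_{p+q,0}C_2$, $[Q_p,Q_q]=\delta_{p+q,0}C_3$, $[H_m,Q_p]=[\mathfrak{g},C_i]=0$. For $\lambda\in\mathbb{C}^*$ and $\beta(y)\in\mathbb{C}[y]$, $\Omega(\lambda,\beta)$ is the $\mathfrak{g}$-module with even part $\mathbb{C}[x,y]$ and odd part $\mathbb{C}[s,t]$ and actions (where, for a two-variable polynomial $f$, $f(x,y)\in\mathbb{C}[x,y]$ and $f(s,t)\in\mathbb{C}[s,t]$ denote the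 polynomial in the respective variables; $m\in\mathbb{Z}$, $p\in\mathbb{Z}+\frac12$): $L_mf(x,y)=\lambda^m(x+m\beta(y))f(x+m,y)$, $L_mf(s,t)=\lambda^m(s+m(\beta(t)+\frac12))f(s+m,t)$, $H_mf(x,y)=\lambda^m yf(x+m,y)$, $H_mf(s,t)=\lambda^m tf(s+m,t)$, $G_pf(x,y)=\lambda^{p-\frac12}f(s+p,t)$, $G_pf(s,t)=\lambda^{p+\frac12}(x+2p\beta(y))f(x+p,y)$, $Q_pf(s,t)=\lambda^{p+\frac12}yf(x+p,y)$, $Q_pf(x,y)=0$, and $C_1,C_2,C_3$ act as $0$.
   Formalization: In (3), when β_0 = 0 the last sentence fails: S_1 has codimension 1, so it is a maximal submodule and is not R_g with deg g = 1; the formal claim is that a maximal submodule is R_g with deg g = 1 or, only if β_0 = 0, equals S_1. *)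

theory Defs
  imports
    Complex_Main
    "HOL-Library.Poly_Mapping"
    "HOL-Library.FuncSet"
    "HOL-Library.Product_Plus"
    "HOL-Computational_Algebra.Polynomial"
    "HOL-Computational_Algebra.Fundamental_Theorem_Algebra"
    "HOL-Algebra.AbelCoset"
    "HOL-Algebra.Module"
begin

section \<open>The N=1 Heisenberg-Virasoro superalgebra\<close>

text \<open>
  Half-integers are encoded by integers: for \<open>k :: int\<close>, the generators \<open>Gg k\<close> and \<open>Qg k\<close>
  stand for the odd basis elements $G_p$ and $Q_p$ with $p = k + 1/2$ (written \<open>half k\<close>).
  Hence $p + q$ for $p$ = \<open>half j\<close> and $q$ = \<open>half k\<close> is the integer \<open>j + k + 1\<close>,
  and $m + p$ is encoded by \<open>m + j\<close>.
\<close>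

datatype gen = Lg int | Hg int | Gg int | Qg int | C1 | C2 | C3

definition half :: "int \<Rightarrow> complex"
  where "half k = of_int k + 1/2"

fun odd_gen :: "gen \<Rightarrow> bool" where
  "odd_gen (Gg k) = True"
| "odd_gen (Qg k) = True"
| "odd_gen _ = False"

type_synonym hv = "gen \<Rightarrow>\<^sub>0 complex"

abbreviation bas :: "gen \<Rightarrow> complex \<Rightarrow> hv"
  where "bas u c \<equiv> Poly_Mapping.single u c"

definition hv_scale :: "complex \<Rightarrow> hv \<Rightarrow> hv"
  where "hv_scale c a = Poly_Mapping.map ((*) c) a"

text \<open>The homogeneous component of \<open>hv\<close> of parity \<open>i\<close>, where \<open>True\<close> means odd.\<close>

definition hv_part :: "bool \<Rightarrow> hv set"
  where "hv_part i = {a. \<forall>u \<in> Poly_Mapping.keys a. odd_gen u = i}"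

fun bracket_gen :: "gen \<Rightarrow> gen \<Rightarrow> hv" where
  "bracket_gen (Lg m) (Lg n) =
     bas (Lg (m + n)) (of_int (m - n)) + bas C1 (if m + n = 0 then of_int (m^3 - m) / 12 else 0)"
| "bracket_gen (Lg m) (Hg n) =
     bas (Hg (m + n)) (- of_int n) + bas C2 (if m + n = 0 then of_int (m^2 + m) else 0)"
| "bracket_gen (Hg n) (Lg m) =
     - (bas (Hg (m + n)) (- of_int n) + bas C2 (if m + n = 0 then of_int (m^2 + m) else 0))"
| "bracket_gen (Hg m) (Hg n) = bas C3 (if m + n = 0 then of_int m else 0)"
| "bracket_gen (Lg m) (Gg j) = bas (Gg (m + j)) (of_int m / 2 - half j)"
| "bracket_gen (Gg j) (Lg m) = - bas (Gg (m + j)) (of_int m / 2 - half j)"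
| "bracket_gen (Lg m) (Qg j) = bas (Qg (m + j)) (- (of_int m / 2 + half j))"
| "bracket_gen (Qg j) (Lg m) = - bas (Qg (m + j)) (- (of_int m / 2 + half j))"
| "bracket_gen (Hg m) (Gg j) = bas (Qg (m + j)) (of_int m)"
| "bracket_gen (Gg j) (Hg m) = - bas (Qg (m + j)) (of_int m)"
| "bracket_gen (Gg j) (Gg k) =
     bas (Lg (j + k + 1)) 2 + bas C1 (if j + k + 1 = 0 then (4 * half j ^ 2 - 1) / 12 else 0)"
| "bracket_gen (Gg j) (Qg k) =
     bas (Hg (j + k + 1)) 1 + bas C2 (if j + k + 1 = 0 then 2 * half j + 1 else 0)"
| "bracket_gen (Qg k) (Gg j) =
     bas (Hg (j + k + 1)) 1 + bas C2 (if j + k + 1 = 0 then 2 * half j + 1 else 0)"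
| "bracket_gen (Qg j) (Qg k) = bas C3 (if j + k + 1 = 0 then 1 else 0)"
| "bracket_gen _ _ = 0"

definition hv_bracket :: "hv \<Rightarrow> hv \<Rightarrow> hv"
  where "hv_bracket a b = (\<Sum>u \<in> Poly_Mapping.keys a. \<Sum>w \<in> Poly_Mapping.keys b.
     hv_scale (poly_mapping.lookup a u * poly_mapping.lookup b w) (bracket_gen u w))"


section \<open>Graded modules and submodules over the superalgebra\<close>

locale hv_module = vector_space scale
  for scale :: "complex \<Rightarrow> 'v::ab_group_add \<Rightarrow> 'v" +
  fixes V :: "bool \<Rightarrow> 'v set"
    and act :: "hv \<Rightarrow> 'v \<Rightarrow> 'v"
  assumes part_subspace: "subspace (V i)"
    and part_direct: "V False \<inter> V True = {0}"
    and part_span: "\<exists>v0 \<in> V False. \<exists>v1 \<in> V True. v = v0 + v1"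
    and act_add: "act (a + b) v = act a v + act b v"
    and act_scale: "act (hv_scale c a) v = scale c (act a v)"
    and act_add_right: "act a (v + w) = act a v + act a w"
    and act_scale_right: "act a (scale c v) = scale c (act a v)"
    and act_part: "\<lbrakk>a \<in> hv_part i; v \<in> V j\<rbrakk> \<Longrightarrow> act a v \<in> V (i \<noteq> j)"
    and act_bracket: "\<lbrakk>a \<in> hv_part i; b \<in> hv_part j\<rbrakk> \<Longrightarrow>
      act (hv_bracket a b) v =
        act a (act b v) - (if i \<and> j then - act b (act a v) else act b (act a v))"
begin

definition submodule :: "'v set \<Rightarrow> bool"
  where "submodule N \<longleftrightarrow> subspace N \<and>
    (\<forall>v \<in> N. \<exists>v0 \<in> N \<inter> V False. \<exists>v1 \<in> N \<inter> V True. v = v0 + v1) \<and>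
    (\<forall>a. \<forall>v \<in> N. act a v \<in> N)"

definition maximal_submodule :: "'v set \<Rightarrow> bool"
  where "maximal_submodule M \<longleftrightarrow> submodule M \<and> M \<noteq> UNIV \<and>
    (\<forall>N. submodule N \<longrightarrow> M \<subseteq> N \<longrightarrow> N = M \<or> N = UNIV)"

end


section \<open>Quotients and free modules\<close>

definition quot_module :: "('a, 'b, 'm) module_scheme \<Rightarrow> 'b set \<Rightarrow> ('a, 'b set) module"
  where "quot_module M N =
    \<lparr>carrier = a_rcosets\<^bsub>M\<^esub> N, mult = undefined, one = undefined,
     zero = N, add = set_add M,
     smult = (\<lambda>r X. \<Union>v \<in> X. N +>\<^bsub>M\<^esub> (r \<odot>\<^bsub>M\<^esub> v))\<rparr>"

definition free_module_of_rank ::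
    "('a, 'm) ring_scheme \<Rightarrow> ('a, 'b, 'n) module_scheme \<Rightarrow> nat \<Rightarrow> bool"
  where "free_module_of_rank R M r \<longleftrightarrow> Module.module R M \<and>
    (\<exists>B. B \<subseteq> carrier M \<and> finite B \<and> card B = r \<and>
      (\<forall>x \<in> carrier M. \<exists>!c. c \<in> B \<rightarrow>\<^sub>E carrier R \<and>
         x = finsum M (\<lambda>b. c b \<odot>\<^bsub>M\<^esub> b) B))"

definition cpoly_ring :: "complex poly ring"
  where "cpoly_ring = \<lparr>carrier = UNIV, mult = (*), one = 1, zero = 0, add = (+)\<rparr>"

text \<open>The module over the polynomial ring $\mathbb{C}[T]$ given by a linear operator \<open>T\<close>.
  The \<open>mult\<close> and \<open>one\<close> fields of a module record carry no meaning.\<close>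

definition operator_module ::
    "(complex \<Rightarrow> 'v \<Rightarrow> 'v) \<Rightarrow> ('v \<Rightarrow> 'v) \<Rightarrow> (complex poly, 'v::ab_group_add) module"
  where "operator_module sc T =
    \<lparr>carrier = UNIV, mult = undefined, one = undefined, zero = 0, add = (+),
     smult = (\<lambda>p v. \<Sum>i\<le>degree p. sc (coeff p i) ((T ^^ i) v))\<rparr>"


section \<open>The modules Omega\<close>

text \<open>
  A two-variable polynomial is an element of $\mathbb{C}[y][x]$: the outer variable of
  \<open>complex poly poly\<close> is $x$ (resp. $s$), the inner one is $y$ (resp. $t$). The first component of \<open>omega\<close> is the even part
  $\mathbb{C}[x,y]$, the second one the odd part $\mathbb{C}[s,t]$.
\<close>

type_synonym poly2 = "complex poly poly"
type_synonym omega = "poly2 \<times> poly2"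

definition X :: poly2 where "X = [:0, 1:]"
definition Y :: poly2 where "Y = [:[:0, 1:]:]"

definition inY :: "complex poly \<Rightarrow> poly2"
  where "inY g = [:g:]"

definition const2 :: "complex \<Rightarrow> poly2"
  where "const2 c = [:[:c:]:]"

text \<open>\<open>shift a f\<close> is $f(x + a, y)$.\<close>

definition shift :: "complex \<Rightarrow> poly2 \<Rightarrow> poly2"
  where "shift a f = pcompose f (X + const2 a)"

definition omega_scale :: "complex \<Rightarrow> omega \<Rightarrow> omega"
  where "omega_scale c v = (const2 c * fst v, const2 c * snd v)"

definition omega_part :: "bool \<Rightarrow> omega set"
  where "omega_part i = (if i then {0} \<times> UNIV else UNIV \<times> {0})"

text \<open>With $p$ = \<open>half k\<close> one has $\lambda^{p-1/2} = \lambda^k$ and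
  $\lambda^{p+1/2} = \lambda^{k+1}$.\<close>

fun omega_gen :: "complex \<Rightarrow> complex poly \<Rightarrow> gen \<Rightarrow> omega \<Rightarrow> omega" where
  "omega_gen lam beta (Lg m) (f, h) =
     (const2 (lam powi m) * (X + const2 (of_int m) * inY beta) * shift (of_int m) f,
      const2 (lam powi m) * (X + const2 (of_int m) * (inY beta + const2 (1/2))) * shift (of_int m) h)"
| "omega_gen lam beta (Hg m) (f, h) =
     (const2 (lam powi m) * Y * shift (of_int m) f,
      const2 (lam powi m) * Y * shift (of_int m) h)"
| "omega_gen lam beta (Gg k) (f, h) =
     (const2 (lam powi (k + 1)) * (X + const2 (2 * half k) * inY beta) * shift (half k) h,
      const2 (lam powi k) * shift (half k) f)"
| "omega_gen lam beta (Qg k) (f, h) =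
     (const2 (lam powi (k + 1)) * Y * shift (half k) h, 0)"
| "omega_gen lam beta _ (f, h) = (0, 0)"

definition omega_act :: "complex \<Rightarrow> complex poly \<Rightarrow> hv \<Rightarrow> omega \<Rightarrow> omega"
  where "omega_act lam beta a v =
    (\<Sum>u \<in> Poly_Mapping.keys a. omega_scale (poly_mapping.lookup a u) (omega_gen lam beta u v))"

abbreviation omega_submodule :: "complex \<Rightarrow> complex poly \<Rightarrow> omega set \<Rightarrow> bool"
  where "omega_submodule lam beta \<equiv>
    hv_module.submodule omega_scale omega_part (omega_act lam beta)"

abbreviation omega_maximal_submodule :: "complex \<Rightarrow> complex poly \<Rightarrow> omega set \<Rightarrow> bool"
  where "omega_maximal_submodule lam beta \<equiv>
    hv_module.maximal_submodule omega_scale omega_part (omega_act lam beta)"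

text \<open>Omega as a module over $\mathbb{C}[L_0]$, a polynomial ring in $L_0$.\<close>

definition omega_L0_module :: "complex \<Rightarrow> complex poly \<Rightarrow> (complex poly, omega) module"
  where "omega_L0_module lam beta =
    operator_module omega_scale (omega_act lam beta (bas (Lg 0) 1))"

definition R_sub :: "complex poly \<Rightarrow> omega set"
  where "R_sub g = {(inY g * f, inY g * h) | f h. True}"

definition S_sub :: "complex poly \<Rightarrow> omega set"
  where "S_sub g = {(inY g * (X * f1 + Y * f2), inY g * h) | f1 f2 h. True}"


section \<open>Omega is a module over the superalgebra\<close>

lemma lookup_hv_scale [simp]: "poly_mapping.lookup (hv_scale c a) u = c * poly_mapping.lookup a u"
  unfolding hv_scale_def by (simp add: Poly_Mapping.map.rep_eq when_def)

lemma const2_simps: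
  "const2 (a + b) = const2 a + const2 b" "const2 (a * b) = const2 a * const2 b"
  "const2 (a - b) = const2 a - const2 b" "const2 (- a) = - const2 a"
  "const2 0 = 0" "const2 1 = 1"
  by (simp_all add: const2_def one_pCons)

lemma shift_simps:
  "shift a (f + h) = shift a f + shift a h" "shift a (f * h) = shift a f * shift a h"
  "shift a 0 = 0" "shift a (inY q) = inY q" "shift a X = X + const2 a"
  "shift a (const2 c) = const2 c" "shift a Y = Y"
  by (simp_all add: shift_def pcompose_add pcompose_mult X_def Y_def inY_def const2_def pcompose_pCons)

lemma shift_shift: "shift a (shift b f) = shift (a + b) f"
proof -
  have "shift a (shift b f) = pcompose f (pcompose (X + const2 b) (X + const2 a))"
    by (simp add: shift_def pcompose_assoc)
  also have "pcompose (X + const2 b) (X + const2 a) = X + const2 (a + b)"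
    by (simp add: X_def const2_def pcompose_pCons)
  finally show ?thesis by (simp add: shift_def)
qed

lemma omega_vector_space: "vector_space omega_scale"
  by unfold_locales (simp_all add: omega_scale_def const2_simps algebra_simps prod_eq_iff)

interpretation omega: vector_space omega_scale
  by (rule omega_vector_space)

lemma omega_gen_add: "omega_gen lam beta u (v + w) = omega_gen lam beta u v + omega_gen lam beta u w"
  by (cases v; cases w; cases u) (simp_all add: shift_simps algebra_simps)

lemma omega_gen_scale: "omega_gen lam beta u (omega_scale c v) = omega_scale c (omega_gen lam beta u v)"
  by (cases v; cases u) (simp_all add: omega_scale_def shift_simps algebra_simps)

lemma omega_act_superset:
  assumes "finite A" "Poly_Mapping.keys a \<subseteq> A"
  shows "omega_act lam beta a v =
    (\<Sum>u\<in>A. omega_scale (poly_mapping.lookup a u) (omega_gen lam beta u v))"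
  unfolding omega_act_def
  by (rule sum.mono_neutral_left) (use assms in \<open>auto simp: in_keys_iff\<close>)

lemma omega_act_add: "omega_act lam beta (a + b) v = omega_act lam beta a v + omega_act lam beta b v"
proof -
  let ?A = "Poly_Mapping.keys a \<union> Poly_Mapping.keys b"
  have "Poly_Mapping.keys (a + b) \<subseteq> ?A" by (rule Poly_Mapping.keys_add)
  then show ?thesis
    by (simp add: omega_act_superset[of ?A] lookup_add omega.scale_left_distrib sum.distrib)
qed

lemma omega_act_scale: "omega_act lam beta (hv_scale c a) v = omega_scale c (omega_act lam beta a v)"
proof -
  have "Poly_Mapping.keys (hv_scale c a) \<subseteq> Poly_Mapping.keys a" by (auto simp: in_keys_iff)
  then show ?thesis
    by (simp add: omega_act_superset[of "Poly_Mapping.keys a"] omega.scale_sum_right)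
qed

lemma omega_act_single: "omega_act lam beta (bas u c) v = omega_scale c (omega_gen lam beta u v)"
  by (simp add: omega_act_superset[of "{u}"])

lemma omega_act_zero: "omega_act lam beta 0 v = 0"
  by (simp add: omega_act_def)

lemma omega_act_minus: "omega_act lam beta (- a) v = - omega_act lam beta a v"
  by (metis omega_act_add omega_act_zero add.right_inverse add_eq_0_iff)

lemma omega_act_diff: "omega_act lam beta (a - b) v = omega_act lam beta a v - omega_act lam beta b v"
  by (metis omega_act_add omega_act_minus diff_conv_add_uminus)

lemma omega_act_sum: "omega_act lam beta (\<Sum>i\<in>I. a i) v = (\<Sum>i\<in>I. omega_act lam beta (a i) v)"
  by (induction I rule: infinite_finite_induct) (simp_all add: omega_act_add omega_act_zero)

lemma omega_act_add_right: "omega_act lam beta a (v + w) = omega_act lam beta a v + omega_act lam beta a w"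
  by (simp add: omega_act_def omega_gen_add omega.scale_right_distrib sum.distrib)

lemma omega_act_scale_right:
  "omega_act lam beta a (omega_scale c v) = omega_scale c (omega_act lam beta a v)"
  by (simp add: omega_act_def omega_gen_scale omega.scale_sum_right mult.commute)

lemma omega_gen_zero: "omega_gen lam beta u 0 = 0"
  by (metis omega_gen_scale omega.scale_zero_left)

lemma omega_gen_sum: "omega_gen lam beta u (\<Sum>i\<in>I. w i) = (\<Sum>i\<in>I. omega_gen lam beta u (w i))"
  by (induction I rule: infinite_finite_induct) (simp_all add: omega_gen_add omega_gen_zero)

lemma const2_of_int: "const2 (of_int m) = of_int m"
  by (cases m) (simp_all add: const2_def of_nat_poly of_int_poly one_pCons)

lemma const2_half: "const2 (half k) = of_int k + const2 (1/2)"
  by (simp add: half_def const2_simps const2_of_int)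

lemma const2_twice_half: "const2 (2 * half k) = 2 * of_int k + 1"
proof -
  have "2 * half k = of_int (2 * k + 1)" by (simp add: half_def)
  then have "const2 (2 * half k) = of_int (2 * k + 1)" by (simp only: const2_of_int)
  then show ?thesis by simp
qed

lemma const2_div_2: "const2 (of_int m / 2) = of_int m * const2 (1/2)"
  using const2_simps(2)[of "of_int m" "1/2"] by (simp add: const2_of_int)

lemma shift_args:
  "of_int m + of_int n = (of_int (m + n) :: complex)"
  "of_int m + half k = half (m + k)" "half k + of_int m = half (k + m)"
  "half j + half k = of_int (j + k + 1)"
  by (simp_all add: half_def)

lemma omega_gen_bracket:
  assumes lam: "lam \<noteq> 0"
  shows "omega_act lam beta (bracket_gen u w) v =
    omega_gen lam beta u (omega_gen lam beta w v) -
     (if odd_gen u \<and> odd_gen w then - omega_gen lam beta w (omega_gen lam beta u v)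
      else omega_gen lam beta w (omega_gen lam beta u v))"
proof -
  obtain f h where v: "v = (f, h)" by force
  define e where "e = const2 (1/2)"
  have e: "2 * e = 1"
  proof -
    have "e + e = 1" unfolding e_def by (simp flip: const2_simps)
    then show ?thesis by (simp only: mult_2)
  qed
  have n: "const2 2 = 2" using const2_of_int[of 2] by simp
  have pw: "const2 (lam powi (m + n)) = const2 (lam powi m) * const2 (lam powi n)" for m n
    by (simp add: power_int_add lam const2_simps)
  have e': "e * 2 = 1" "e * (2 * z) = z" "e * (z * 2) = z" for z
    using e by (auto simp: algebra_simps)
  have e2: "e * (a * (2 * z)) = a * z" "e * (a * (b * (2 * z))) = a * (b * z)"
      "e * (a * (b * (c * (2 * z)))) = a * (b * (c * z))"
      "e * (a * (b * (c * (d * (2 * z))))) = a * (b * (c * (d * z)))" for a b c d z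
    using e' by (metis mult.left_commute)+
  have e4: "e * (a * (b * (c * (d * (k * (l * (4 * z))))))) = 2 * (a * (b * (c * (d * (k * (l * z))))))"
    for a b c d k l z :: poly2
  proof -
    have "e * (a * (b * (c * (d * (k * (l * (4 * z))))))) =
        (2 * e) * (2 * (a * (b * (c * (d * (k * (l * z)))))))" by simp
    then show ?thesis by (simp only: e mult_1)
  qed
  note basic = v omega_act_add omega_act_minus omega_act_diff omega_act_zero omega_act_single omega_scale_def
      shift_simps shift_shift shift_args zero_prod_def
  note cfacts = n pw const2_twice_half const2_simps const2_half const2_div_2 const2_of_int e_def[symmetric]
  show ?thesis
    apply (cases u; cases w)
    apply (simp_all del: of_int_add of_int_diff of_int_minus add: basic)
    apply (simp_all add: cfacts add.commute)
    apply (simp_all add: algebra_simps e')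
    apply (simp_all add: e2 e4)
    done
qed

lemma omega_act_act:
  "omega_act lam beta a (omega_act lam beta b v) =
    (\<Sum>u \<in> Poly_Mapping.keys a. \<Sum>w \<in> Poly_Mapping.keys b.
      omega_scale (poly_mapping.lookup a u * poly_mapping.lookup b w)
        (omega_gen lam beta u (omega_gen lam beta w v)))"
  by (simp add: omega_act_def omega_gen_sum omega_gen_scale omega.scale_sum_right)

lemma omega_act_bracket:
  assumes lam: "lam \<noteq> 0" and ab: "a \<in> hv_part i" "b \<in> hv_part j"
  shows "omega_act lam beta (hv_bracket a b) v =
    omega_act lam beta a (omega_act lam beta b v) -
     (if i \<and> j then - omega_act lam beta b (omega_act lam beta a v)
      else omega_act lam beta b (omega_act lam beta a v))"
proof -
  let ?s = "\<lambda>x :: omega. if i \<and> j then - x else x"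
  let ?g = "omega_gen lam beta"
  let ?c = "\<lambda>u w. poly_mapping.lookup a u * poly_mapping.lookup b w"
  have s_sum: "?s (sum k I) = (\<Sum>x\<in>I. ?s (k x))" for k :: "gen \<Rightarrow> omega" and I
    by (cases "i \<and> j") (auto simp: sum_negf)
  have s_scale: "omega_scale c (?s x) = ?s (omega_scale c x)" for c x
    by (simp add: omega.scale_minus_right)
  have "omega_act lam beta (hv_bracket a b) v =
    (\<Sum>u \<in> Poly_Mapping.keys a. \<Sum>w \<in> Poly_Mapping.keys b.
      omega_scale (?c u w) (?g u (?g w v)) - ?s (omega_scale (?c u w) (?g w (?g u v))))"
    unfolding hv_bracket_def omega_act_sum omega_act_scale
  proof (intro sum.cong refl)
    fix u w assume "u \<in> Poly_Mapping.keys a" "w \<in> Poly_Mapping.keys b"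
    then have p: "odd_gen u = i" "odd_gen w = j" using ab by (auto simp: hv_part_def)
    show "omega_scale (?c u w) (omega_act lam beta (bracket_gen u w) v) =
      omega_scale (?c u w) (?g u (?g w v)) - ?s (omega_scale (?c u w) (?g w (?g u v)))"
      unfolding omega_gen_bracket[OF lam] p omega.scale_right_diff_distrib s_scale ..
  qed
  also have "\<dots> = omega_act lam beta a (omega_act lam beta b v) -
     ?s (\<Sum>u \<in> Poly_Mapping.keys a. \<Sum>w \<in> Poly_Mapping.keys b.
       omega_scale (?c u w) (?g w (?g u v)))"
    unfolding omega_act_act s_sum sum_subtractf ..
  also have "(\<Sum>u \<in> Poly_Mapping.keys a. \<Sum>w \<in> Poly_Mapping.keys b.
       omega_scale (?c u w) (?g w (?g u v))) = omega_act lam beta b (omega_act lam beta a v)"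
    unfolding omega_act_act by (subst sum.swap) (simp add: mult.commute)
  finally show ?thesis .
qed

lemma omega_part_subspace: "omega.subspace (omega_part i)"
  by (auto simp: omega.subspace_def omega_part_def omega_scale_def zero_prod_def)

lemma omega_gen_part: "v \<in> omega_part j \<Longrightarrow> omega_gen lam beta u v \<in> omega_part (odd_gen u \<noteq> j)"
  by (cases v; cases u) (auto simp: omega_part_def shift_simps split: if_splits)

lemma omega_hv_module:
  assumes lam: "lam \<noteq> 0"
  shows "hv_module omega_scale omega_part (omega_act lam beta)"
proof
  fix i show "omega.subspace (omega_part i)" by (rule omega_part_subspace)
next
  show "omega_part False \<inter> omega_part True = {0}"
    by (auto simp: omega_part_def zero_prod_def)
next
  fix v :: omega
  obtain f h where v: "v = (f, h)" by force
  show "\<exists>v0\<in>omega_part False. \<exists>v1\<in>omega_part True. v = v0 + v1"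
    by (rule bexI[of _ "(f, 0)"], rule bexI[of _ "(0, h)"]) (auto simp: v omega_part_def)
next
  fix a v i j assume a: "a \<in> hv_part i" and v: "v \<in> omega_part j"
  show "omega_act lam beta a v \<in> omega_part (i \<noteq> j)"
    unfolding omega_act_def
  proof (intro omega.subspace_sum[OF omega_part_subspace] omega.subspace_scale[OF omega_part_subspace])
    fix u assume "u \<in> Poly_Mapping.keys a"
    then have "odd_gen u = i" using a by (auto simp: hv_part_def)
    then show "omega_gen lam beta u v \<in> omega_part (i \<noteq> j)" using omega_gen_part[OF v] by blast
  qed
qed (rule omega_act_add omega_act_scale omega_act_add_right omega_act_scale_right
       omega_act_bracket[OF lam], assumption?)+

section \<open>A maximal submodule that is not of the form \<open>R_sub g\<close>\<close>

text \<open>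
  If the constant term of \<open>beta\<close> vanishes, \<open>S_sub 1\<close> has codimension one in Omega, so it is
  a maximal submodule, and it differs from every \<open>R_sub g\<close> with \<open>degree g = 1\<close>.
\<close>

definition const_term :: "poly2 \<Rightarrow> complex"
  where "const_term f = poly (poly f 0) 0"

lemma const_term_simps:
  "const_term (f + h) = const_term f + const_term h" "const_term (f * h) = const_term f * const_term h"
  "const_term 0 = 0" "const_term X = 0" "const_term Y = 0"
  "const_term (inY g) = coeff g 0" "const_term (const2 c) = c"
  by (simp_all add: const_term_def X_def Y_def inY_def const2_def flip: poly_0_coeff_0)

lemma S_sub_one: "S_sub 1 = {v. const_term (fst v) = 0}"
proof (intro equalityI subsetI)
  fix v assume "v \<in> S_sub 1"
  then show "v \<in> {v. const_term (fst v) = 0}"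
    by (auto simp: S_sub_def const_term_simps)
next
  fix v :: omega assume "v \<in> {v. const_term (fst v) = 0}"
  then obtain f h where v: "v = (f, h)" and f: "const_term f = 0" by (cases v) auto
  obtain c f1 where f1: "f = pCons c f1" by (cases f)
  obtain d c1 where c1: "c = pCons d c1" by (cases c)
  have "d = 0" using f by (simp add: const_term_def f1 c1)
  then have "f = X * f1 + Y * [:c1:]" by (simp add: f1 c1 X_def Y_def)
  then show "v \<in> S_sub 1"
    unfolding S_sub_def v inY_def pCons_one by (simp, blast)
qed

lemma S_sub_one_maximal:
  assumes lam: "lam \<noteq> 0" and beta: "coeff beta 0 = 0"
  shows "omega_maximal_submodule lam beta (S_sub 1)"
    and "degree g = 1 \<Longrightarrow> S_sub 1 \<noteq> R_sub g"
proof -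
  interpret hv_module omega_scale omega_part "omega_act lam beta"
    by (rule omega_hv_module[OF lam])
  have sub: "omega.subspace (S_sub 1)"
    by (auto simp: omega.subspace_def S_sub_one omega_scale_def const_term_simps)
  have gen: "omega_gen lam beta u v \<in> S_sub 1" if "v \<in> S_sub 1" for u v
    using that by (cases v; cases u) (auto simp: S_sub_one const_term_simps beta)
  have 1: "submodule (S_sub 1)"
    unfolding submodule_def
  proof (intro conjI ballI allI sub)
    fix v :: omega assume "v \<in> S_sub 1"
    then show "\<exists>v0\<in>S_sub 1 \<inter> omega_part False. \<exists>v1\<in>S_sub 1 \<inter> omega_part True. v = v0 + v1"
      by (intro bexI[of _ "(fst v, 0)"] bexI[of _ "(0, snd v)"])
         (auto simp: S_sub_one omega_part_def const_term_simps prod_eq_iff)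
  next
    fix a v assume "v \<in> S_sub 1"
    then show "omega_act lam beta a v \<in> S_sub 1"
      unfolding omega_act_def
      by (intro omega.subspace_sum[OF sub] omega.subspace_scale[OF sub] gen)
  qed
  have 2: "(1, 0) \<notin> S_sub 1" by (simp add: S_sub_one const_term_def)
  have 3: "N = UNIV" if N: "submodule N" "S_sub 1 \<subseteq> N" and v: "v \<in> N" "v \<notin> S_sub 1" for N v
  proof -
    have sN: "omega.subspace N" using N by (simp add: submodule_def)
    define c where "c = const_term (fst v)"
    have c: "c \<noteq> 0" using v by (simp add: S_sub_one c_def)
    have "w \<in> N" for w :: omega
    proof -
      define k where "k = const_term (fst w) / c"
      have "const_term (fst w) = k * c" using c by (simp add: k_def)
      moreover have "fst (w - omega_scale k v) + const2 k * fst v = fst w"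
        by (simp add: omega_scale_def)
      ultimately have "const_term (fst (w - omega_scale k v)) = 0"
        by (metis (no_types) add_cancel_left_left c_def const_term_simps(1,2,7))
      then have "w - omega_scale k v \<in> N" using N by (auto simp: S_sub_one)
      then have "(w - omega_scale k v) + omega_scale k v \<in> N"
        using v by (intro omega.subspace_add[OF sN] omega.subspace_scale[OF sN])
      then show ?thesis by simp
    qed
    then show ?thesis by blast
  qed
  show "omega_maximal_submodule lam beta (S_sub 1)"
    unfolding maximal_submodule_def using 1 2 3 by blast
  show "S_sub 1 \<noteq> R_sub g" if deg: "degree g = 1"
  proof
    assume "S_sub 1 = R_sub g"
    moreover have "(0, 1) \<in> S_sub 1" by (simp add: S_sub_one const_term_simps)
    ultimately obtain h where h: "1 = inY g * h" by (auto simp: R_sub_def)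
    obtain z where "poly g z = 0"
      using deg fundamental_theorem_of_algebra[of g] by (auto simp: constant_degree)
    moreover have "poly (poly (inY g * h) 0) z = poly g z * poly (poly h 0) z"
      by (simp add: inY_def)
    ultimately show False using h[symmetric] by simp
  qed
qed

end

theory Submission
  imports Defs
begin

text \<open>
  \<^bold>\<open>Submodules.\<close> A submodule is the sum of its even part \<open>E\<close> in \<open>\<complex>[x, y]\<close> and its odd part \<open>O\<close> in
  \<open>\<complex>[s, t]\<close>, and both are ideals because \<open>L_0\<close> and \<open>H_0\<close> act as multiplication by the two variables.
  The odd generators give, for all half-integers \<open>p\<close>,
  \<^item> \<open>f(s + p, t) \<in> O\<close> if \<open>f \<in> E\<close>;
  \<^item> \<open>y h(x + p, y) \<in> E\<close> and \<open>(x + 2 p \<beta>(y)) h(x + p, y) \<in> E\<close> if \<open>h \<in> O\<close>.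

  Each of these elements is the value at \<open>T = x + p\<close> of a polynomial in a new variable \<open>T\<close> whose
  coefficients do not depend on \<open>p\<close>; for the last one \<open>p = T - x\<close> is substituted in the first factor.
  Infinitely many values in an ideal, at points with invertible differences, force all coefficients
  into that ideal (\<open>coeff_in_ideal_if_values_in_ideal\<close>). With \<open>f = \<Sum> f_i(y) x^i\<close> and
  \<open>h = \<Sum> h_i(t) s^i\<close> this gives \<open>f_i \<in> O\<close> and \<open>y h_i \<in> E\<close> and, modulo the latter,
  \<open>(1 - 2 \<beta>_0) x h_i + 2 \<beta>_0 h_(i - 1) \<in> E\<close>. If \<open>\<beta>_0 = 0\<close>, the last relation says \<open>x h_i \<in> E\<close>;
  otherwise it yields \<open>h_i \<in> E\<close> by descending induction on \<open>i\<close>. In both cases \<open>x h_i \<in> E\<close>, hence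
  \<open>h_i \<in> O\<close>.

  So all coefficients of elements of \<open>E\<close> and \<open>O\<close> belong to the ideal of the polynomials in \<open>t\<close>
  alone that lie in \<open>O\<close>, which is principal, say \<open>(g)\<close>. Then \<open>O = (g)\<close> and
  \<open>g (x, y) \<subseteq> E \<subseteq> (g)\<close>. The outer ideals are equal or differ by one dimension, so the submodule is
  \<open>S_g\<close> or \<open>R_g\<close>, and it is \<open>R_g\<close> if \<open>\<beta>_0 \<noteq> 0\<close>, because then \<open>g\<close> itself lies in \<open>E\<close>
  (\<open>omega_submodule_cases\<close>). Conversely, multiplication by \<open>g\<close> commutes with the action, so it maps
  the submodules \<open>R_1\<close> and, if \<open>\<beta>_0 = 0\<close>, \<open>S_1\<close> to submodules \<open>R_g\<close> and \<open>S_g\<close>. Maximal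
  submodules are found by comparing with the submodules of linear polynomials, since a \<open>g\<close> which is
  not a unit has a root; for a unit \<open>g\<close> only \<open>S_g = S_1\<close> is proper.

  \<^bold>\<open>Quotients.\<close> \<open>L_0\<close> acts as multiplication by \<open>x\<close> and \<open>s\<close>. Division with remainder by \<open>g(y)\<close>,
  applied to the coefficients of the powers of \<open>x\<close>, shows that \<open>1, y, ..., y^(deg g - 1)\<close> form
  a basis of \<open>\<complex>[x, y]\<close> modulo \<open>g(y)\<close> over \<open>\<complex>[x]\<close>. The two parities together
  give rank \<open>2 deg g\<close> (\<open>free_quotient_R_sub\<close>).
\<close>

section \<open>Ideals of polynomial rings\<close>

text \<open>
  A commutative ring is a module over itself, and the submodules are the ideals; in the following
  \<open>self.subspace I\<close> therefore says that \<open>I\<close> is an ideal.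
\<close>

interpretation self: Modules.module "(*) :: 'a::comm_ring_1 \<Rightarrow> 'a \<Rightarrow> 'a"
  by unfold_locales (simp_all add: algebra_simps)

text \<open>As a rewrite rule this is associativity, directed against \<open>mult.assoc\<close>.\<close>

declare self.scale_scale [simp del]

text \<open>
  This is the Vandermonde argument modulo an ideal. If one value \<open>poly f t\<close> lies in \<open>I\<close>, then
  \<open>f\<close> agrees modulo \<open>I\<close> with \<open>(T - t) * q\<close>, where \<open>T\<close> is the variable of \<open>f\<close>. At the
  other points the factor \<open>T - t\<close> takes unit values, so the values of \<open>q\<close>, which has smaller
  degree, lie in \<open>I\<close> there.
\<close>

lemma coeff_in_ideal_if_values_in_ideal:
  fixes f :: "'a::comm_ring_1 poly"
  assumes "self.subspace I" and "infinite S"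
    and "\<And>s t. s \<in> S \<Longrightarrow> t \<in> S \<Longrightarrow> s \<noteq> t \<Longrightarrow> (s - t) dvd 1"
    and "\<And>t. t \<in> S \<Longrightarrow> poly f t \<in> I"
  shows "coeff f i \<in> I"
  using assms(2-)
proof (induction "degree f" arbitrary: f S i)
  case 0
  obtain t where "t \<in> S" using infinite_imp_nonempty[OF 0(2)] by blast
  moreover obtain a where "f = [:a:]" using 0 by (metis degree_eq_zeroE)
  ultimately have "a \<in> I" using 0 by fastforce
  then show ?case
    using \<open>f = [:a:]\<close> self.subspace_0[OF assms(1)] by (cases i) auto
next
  case (Suc n)
  obtain t where t: "t \<in> S" using infinite_imp_nonempty[OF Suc.prems(1)] by blast
  define q where "q = synthetic_div f t"
  have f: "f = [:- t, 1:] * q + [:poly f t:]"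
    unfolding q_def by (rule synthetic_div_correct'[symmetric])
  have deg: "n = degree q" using Suc.hyps(2) by (simp add: q_def degree_synthetic_div)
  have q: "coeff q j \<in> I" for j
  proof (rule Suc.hyps(1)[OF deg, of "S - {t}"])
    show "infinite (S - {t})" using Suc.prems(1) by simp
  next
    fix s assume s: "s \<in> S - {t}"
    then obtain u where u: "1 = (s - t) * u" using Suc.prems(2)[of s t] t by (auto elim: dvdE)
    have "poly f s = (s - t) * poly q s + poly f t"
      by (subst f) (simp add: algebra_simps)
    then have "(s - t) * poly q s = poly f s - poly f t" by simp
    then have "(s - t) * poly q s \<in> I"
      using s t Suc.prems(3) self.subspace_diff[OF assms(1)] by simp
    then have "u * ((s - t) * poly q s) \<in> I"
      by (rule self.subspace_scale[OF assms(1)])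
    moreover have "u * ((s - t) * poly q s) = ((s - t) * u) * poly q s"
      by (simp only: mult_ac)
    ultimately show "poly q s \<in> I" by (simp flip: u)
  qed (use Suc.prems(2) in auto)
  have "coeff f i = - t * coeff q i + coeff (pCons (poly f t) q) i"
    by (subst f) (simp add: coeff_pCons split: nat.splits)
  also have "\<dots> \<in> I"
  proof (intro self.subspace_add[OF assms(1)] self.subspace_scale[OF assms(1)] q)
    show "coeff (pCons (poly f t) q) i \<in> I"
      using q Suc.prems(3)[OF t] by (simp add: coeff_pCons split: nat.splits)
  qed
  finally show ?case .
qed

lemma principal_ideal_poly:
  fixes J :: "'a::field poly set"
  assumes J: "self.subspace J"
  shows "\<exists>g. J = {q. g dvd q}"
proof (cases "J = {0}")
  case True
  then show ?thesis by (intro exI[of _ 0]) auto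
next
  case False
  define g where "g = arg_min degree (\<lambda>q. q \<in> J \<and> q \<noteq> 0)"
  have "\<exists>q. q \<in> J \<and> q \<noteq> 0" using False self.subspace_0[OF J] by blast
  then have g: "g \<in> J" "g \<noteq> 0" and min: "\<And>q. q \<in> J \<Longrightarrow> q \<noteq> 0 \<Longrightarrow> degree g \<le> degree q"
    unfolding g_def by (metis (mono_tags, lifting) arg_min_nat_lemma)+
  have "g dvd q" if "q \<in> J" for q
  proof -
    have "q mod g = q - (q div g) * g" by (simp add: minus_div_mult_eq_mod)
    also have "\<dots> \<in> J"
      by (intro self.subspace_diff[OF J] self.subspace_scale[OF J] that g)
    finally have "q mod g \<in> J" .
    then have "q mod g = 0"
      using min[of "q mod g"] degree_mod_less'[OF g(2), of q] by linarith
    then show ?thesis by (simp add: dvd_eq_mod_eq_0)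
  qed
  then have "J = {q. g dvd q}"
    using self.subspace_scale[OF J g(1)] by (auto elim!: dvdE simp: mult.commute)
  then show ?thesis ..
qed


section \<open>Two-variable polynomials\<close>

lemma inY_simps:
  "inY (f + g) = inY f + inY g" "inY (f - g) = inY f - inY g" "inY (f * g) = inY f * inY g"
  "inY 0 = 0" "inY 1 = 1" "inY [:c:] = const2 c"
  by (simp_all add: inY_def const2_def one_pCons)

lemma pCons_eq_inY: "pCons a f = inY a + X * f"
  by (simp add: inY_def X_def)

lemma inY_pCons: "inY (pCons c q) = const2 c + Y * inY q"
  by (simp add: inY_def const2_def Y_def)

text \<open>\<open>X\<close>, \<open>Y\<close> and the constants generate the ring, so invariance under them makes an ideal.\<close>

lemma ideal_if_closed_X_Y:
  assumes zero: "0 \<in> I" and add: "\<And>f h. f \<in> I \<Longrightarrow> h \<in> I \<Longrightarrow> f + h \<in> I"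
    and const: "\<And>c f. f \<in> I \<Longrightarrow> const2 c * f \<in> I"
    and multX: "\<And>f. f \<in> I \<Longrightarrow> X * f \<in> I" and multY: "\<And>f. f \<in> I \<Longrightarrow> Y * f \<in> I"
  shows "self.subspace I"
proof (rule self.subspaceI)
  have inY: "inY q * f \<in> I" if "f \<in> I" for q f
  proof (induction q)
    case (pCons c q)
    then show ?case
      using that by (simp add: inY_pCons distrib_right mult.assoc add const multY)
  qed (simp add: zero inY_simps)
  show "h * f \<in> I" if "f \<in> I" for h f
  proof (induction h)
    case (pCons a h)
    then show ?case
      using that by (simp add: pCons_eq_inY distrib_right mult.assoc add inY multX)
  qed (simp add: zero)
qed (fact zero add)+

lemma shift_eq_poly: "shift a f = poly (map_poly inY f) (X + const2 a)"
  unfolding shift_def pcompose_altdef inY_def ..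

lemma coeff_map_poly_inY: "coeff (map_poly inY f) i = inY (coeff f i)"
  by (rule coeff_map_poly) (simp add: inY_simps)

text \<open>
  The half-integer translates of \<open>X\<close> differ by nonzero constants, which are units.
\<close>

lemma coeff_in_ideal_if_half_shifts:
  assumes I: "self.subspace I" and F: "\<And>k. poly F (X + const2 (half k)) \<in> I"
  shows "coeff F i \<in> I"
proof (rule coeff_in_ideal_if_values_in_ideal[OF I])
  let ?S = "range (\<lambda>k. X + const2 (half k))"
  have "inj (\<lambda>k. X + const2 (half k))"
    by (auto simp: inj_def const2_def half_def)
  then show "infinite ?S" by (simp add: finite_image_iff)
  fix s t assume st: "s \<in> ?S" "t \<in> ?S" "s \<noteq> t"
  then obtain j k where s: "s = X + const2 (half j)" and t: "t = X + const2 (half k)" by auto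
  have "half j - half k \<noteq> 0" using st(3) by (auto simp: s t)
  then have "(s - t) * const2 (1 / (half j - half k)) = 1"
    by (simp add: s t flip: const2_simps)
  then show "(s - t) dvd 1" by (metis dvd_triv_left)
qed (use F in auto)

lemma const_term_decomp: "\<exists>f1 f2. f = const2 (const_term f) + X * f1 + Y * f2"
proof -
  obtain a f1 where f: "f = pCons a f1" by (cases f)
  obtain c q where a: "a = pCons c q" by (cases a)
  have "const_term f = c" by (simp add: const_term_def f a)
  moreover have "f = const2 c + X * f1 + Y * inY q"
    by (simp add: f a pCons_eq_inY inY_pCons)
  ultimately show ?thesis by blast
qed

lemma const_term_zero_iff: "const_term f = 0 \<longleftrightarrow> (\<exists>f1 f2. f = X * f1 + Y * f2)"
proof
  assume "const_term f = 0"
  then show "\<exists>f1 f2. f = X * f1 + Y * f2"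
    using const_term_decomp[of f] by (simp add: const2_simps)
qed (auto simp: const_term_simps)


section \<open>Submodules of Omega\<close>

lemma R_sub_eq: "R_sub g = (\<lambda>v. (inY g * fst v, inY g * snd v)) ` UNIV"
  by (auto simp: R_sub_def image_iff)

lemma mem_S_sub_iff:
  "v \<in> S_sub g \<longleftrightarrow> (\<exists>f h. const_term f = 0 \<and> v = (inY g * f, inY g * h))"
  unfolding const_term_zero_iff S_sub_def by blast

lemma S_sub_eq: "S_sub g = (\<lambda>v. (inY g * fst v, inY g * snd v)) ` S_sub 1"
proof (intro equalityI subsetI)
  fix v assume "v \<in> S_sub g"
  then obtain f h where "const_term f = 0" "v = (inY g * f, inY g * h)"
    unfolding mem_S_sub_iff by blast
  then show "v \<in> (\<lambda>v. (inY g * fst v, inY g * snd v)) ` S_sub 1"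
    by (intro image_eqI[of _ _ "(f, h)"]) (simp_all add: S_sub_one)
qed (auto simp: S_sub_one mem_S_sub_iff)

lemma R_sub_mono: "g' dvd g \<Longrightarrow> R_sub g \<subseteq> R_sub g'"
  by (force simp: R_sub_def inY_simps mult.assoc elim!: dvdE)

lemma S_sub_subset_R_sub: "S_sub g \<subseteq> R_sub g"
  by (auto simp: S_sub_def R_sub_def)

lemma R_sub_eq_UNIV_iff: "R_sub g = UNIV \<longleftrightarrow> g dvd 1"
proof
  assume "R_sub g = UNIV"
  then have "(1, 0) \<in> R_sub g" by simp
  then have "inY g dvd 1" by (auto simp: R_sub_def intro: dvdI)
  then show "g dvd 1" by (simp add: inY_def is_unit_const_poly_iff)
next
  assume "g dvd 1"
  then have "R_sub 1 \<subseteq> R_sub g" by (rule R_sub_mono)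
  moreover have "R_sub 1 = UNIV" by (auto simp: R_sub_def inY_simps)
  ultimately show "R_sub g = UNIV" by blast
qed

lemma R_sub_linear_above:
  assumes "\<not> g dvd 1"
  shows "\<exists>z. R_sub g \<subseteq> R_sub [:- z, 1:]"
proof -
  have "\<exists>z. poly g z = 0"
  proof (cases "g = 0")
    case False
    then have "degree g \<noteq> 0" using assms by (simp add: is_unit_iff_degree)
    then show ?thesis
      using fundamental_theorem_of_algebra[of g] by (auto simp: constant_degree)
  qed simp
  then show ?thesis using R_sub_mono by (metis poly_eq_0_iff_dvd)
qed

context
  fixes lam :: complex and beta :: "complex poly"
  assumes lam: "lam \<noteq> 0"
begin

interpretation hv_module omega_scale omega_part "omega_act lam beta"
  by (rule omega_hv_module[OF lam])

lemma omega_submoduleI: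
  assumes sub: "omega.subspace N"
    and graded: "\<And>v. v \<in> N \<Longrightarrow> (fst v, 0) \<in> N"
    and gen: "\<And>u v. v \<in> N \<Longrightarrow> omega_gen lam beta u v \<in> N"
  shows "submodule N"
  unfolding submodule_def
proof (intro conjI ballI allI sub)
  fix v assume v: "v \<in> N"
  have "v - (fst v, 0) \<in> N" by (intro omega.subspace_diff[OF sub] v graded)
  moreover have "v - (fst v, 0) = (0, snd v)" by (simp add: prod_eq_iff)
  ultimately show "\<exists>v0\<in>N \<inter> omega_part False. \<exists>v1\<in>N \<inter> omega_part True. v = v0 + v1"
    using graded[OF v]
    by (intro bexI[of _ "(fst v, 0)"] bexI[of _ "(0, snd v)"])
       (auto simp: omega_part_def prod_eq_iff)
next
  fix a v assume "v \<in> N"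
  then show "omega_act lam beta a v \<in> N"
    unfolding omega_act_def
    by (intro omega.subspace_sum[OF sub] omega.subspace_scale[OF sub] gen)
qed

lemma omega_submodule_gen:
  assumes "submodule N" and "v \<in> N"
  shows "omega_gen lam beta u v \<in> N"
proof -
  have "omega_act lam beta (bas u 1) v \<in> N" using assms by (simp add: submodule_def)
  then show ?thesis by (simp add: omega_act_single)
qed

lemma omega_submodule_components:
  assumes "submodule N" and "(f, h) \<in> N"
  shows "(f, 0) \<in> N" and "(0, h) \<in> N"
proof -
  obtain v0 v1 where "v0 \<in> N \<inter> omega_part False" "v1 \<in> N \<inter> omega_part True" "(f, h) = v0 + v1"
    using assms unfolding submodule_def by meson
  then show "(f, 0) \<in> N" and "(0, h) \<in> N"
    by (cases v0; cases v1; auto simp: omega_part_def zero_prod_def)+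
qed

text \<open>
  The generators only shift the variables \<open>x\<close> and \<open>s\<close>, so multiplication by a polynomial in the
  other variable is an endomorphism of the module.
\<close>

lemma omega_gen_inY_mult:
  "omega_gen lam beta u (inY g * f, inY g * h) =
    (inY g * fst (omega_gen lam beta u (f, h)), inY g * snd (omega_gen lam beta u (f, h)))"
  by (cases u) (simp_all add: shift_simps algebra_simps)

lemma submodule_inY_image:
  assumes N: "submodule N"
  shows "submodule ((\<lambda>v. (inY g * fst v, inY g * snd v)) ` N)"
proof (rule omega_submoduleI)
  let ?m = "\<lambda>v. (inY g * fst v, inY g * snd v)"
  have sub: "omega.subspace N" using N by (simp add: submodule_def)
  show "omega.subspace (?m ` N)"
  proof (rule omega.subspaceI)
    show "0 \<in> ?m ` N"
      using omega.subspace_0[OF sub] by (force simp: prod_eq_iff)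
    show "v + w \<in> ?m ` N" if vw: "v \<in> ?m ` N" "w \<in> ?m ` N" for v w
    proof -
      obtain v' w' where "v = ?m v'" "w = ?m w'" "v' \<in> N" "w' \<in> N" using vw by blast
      then have "v + w = ?m (v' + w')" "v' + w' \<in> N"
        using omega.subspace_add[OF sub] by (simp_all add: distrib_left)
      then show ?thesis by (rule image_eqI)
    qed
    show "omega_scale c v \<in> ?m ` N" if vN: "v \<in> ?m ` N" for c v
    proof -
      obtain v' where "v = ?m v'" "v' \<in> N" using vN by blast
      then have "omega_scale c v = ?m (omega_scale c v')" "omega_scale c v' \<in> N"
        using omega.subspace_scale[OF sub] by (simp_all add: omega_scale_def mult.left_commute)
      then show ?thesis by (rule image_eqI)
    qed
  qed
next
  fix v assume "v \<in> (\<lambda>v. (inY g * fst v, inY g * snd v)) ` N"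
  then obtain f h where v: "v = (inY g * f, inY g * h)" and fh: "(f, h) \<in> N" by force
  show "(fst v, 0) \<in> (\<lambda>v. (inY g * fst v, inY g * snd v)) ` N"
    using omega_submodule_components(1)[OF N fh] by (force simp: v)
  show "omega_gen lam beta u v \<in> (\<lambda>v. (inY g * fst v, inY g * snd v)) ` N" for u
    unfolding v omega_gen_inY_mult using omega_submodule_gen[OF N fh] by blast
qed

lemma submodule_R_sub: "submodule (R_sub g)"
  unfolding R_sub_eq by (intro submodule_inY_image omega_submoduleI) auto

lemma submodule_S_sub: "coeff beta 0 = 0 \<Longrightarrow> submodule (S_sub g)"
  using S_sub_one_maximal(1)[OF lam, of beta] submodule_inY_image[of "S_sub 1" g]
  by (simp add: maximal_submodule_def flip: S_sub_eq)

text \<open>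
  \<open>L_0\<close> and \<open>H_0\<close> act by multiplication with the two variables, so both homogeneous components
  of a submodule are ideals.
\<close>

lemma submodule_component_ideals:
  assumes N: "submodule N"
  shows "self.subspace {f. (f, 0) \<in> N}" and "self.subspace {h. (0, h) \<in> N}"
proof -
  have sub: "omega.subspace N" using N by (simp add: submodule_def)
  have 0: "(0, 0) \<in> N" using omega.subspace_0[OF sub] by (simp add: zero_prod_def)
  have add: "v + w \<in> N" if "v \<in> N" "w \<in> N" for v w
    using that by (rule omega.subspace_add[OF sub])
  have sc: "omega_scale c v \<in> N" if "v \<in> N" for c v
    using that by (rule omega.subspace_scale[OF sub])
  have shift0: "shift 0 f = f" for f
    by (simp add: shift_def const2_simps X_def pcompose_idR)
  have L: "(X * f, X * h) \<in> N" and H: "(Y * f, Y * h) \<in> N" if "(f, h) \<in> N" for f h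
    using omega_submodule_gen[OF N that, of "Lg 0"] omega_submodule_gen[OF N that, of "Hg 0"]
    by (simp_all add: const2_simps shift0)
  show "self.subspace {f. (f, 0) \<in> N}"
  proof (rule ideal_if_closed_X_Y)
    show "f + h \<in> {f. (f, 0) \<in> N}" if "f \<in> {f. (f, 0) \<in> N}" "h \<in> {f. (f, 0) \<in> N}" for f h
      using that add[of "(f, 0)" "(h, 0)"] by simp
    show "const2 c * f \<in> {f. (f, 0) \<in> N}" if "f \<in> {f. (f, 0) \<in> N}" for c f
      using that sc[of "(f, 0)" c] by (simp add: omega_scale_def)
  qed (use 0 L[of _ 0] H[of _ 0] in auto)
  show "self.subspace {h. (0, h) \<in> N}"
  proof (rule ideal_if_closed_X_Y)
    show "f + h \<in> {h. (0, h) \<in> N}" if "f \<in> {h. (0, h) \<in> N}" "h \<in> {h. (0, h) \<in> N}" for f h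
      using that add[of "(0, f)" "(0, h)"] by simp
    show "const2 c * f \<in> {h. (0, h) \<in> N}" if "f \<in> {h. (0, h) \<in> N}" for c f
      using that sc[of "(0, f)" c] by (simp add: omega_scale_def)
  qed (use 0 L[of 0] H[of 0] in auto)
qed

text \<open>
  The powers of \<open>lam\<close> in front of the action are units, so a submodule is also invariant
  under the actions of \<open>G_p\<close> and \<open>Q_p\<close> without them.
\<close>

lemma submodule_shifts:
  assumes N: "submodule N"
  shows "(f, 0) \<in> N \<Longrightarrow> (0, shift (half k) f) \<in> N"
    and "(0, h) \<in> N \<Longrightarrow> (Y * shift (half k) h, 0) \<in> N"
    and "(0, h) \<in> N \<Longrightarrow> ((X + const2 (2 * half k) * inY beta) * shift (half k) h, 0) \<in> N"
proof -
  have sub: "omega.subspace N" using N by (simp add: submodule_def)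
  have cancel: "v \<in> N" if "omega_scale c v \<in> N" "c \<noteq> 0" for c v
    using omega.subspace_scale[OF sub that(1), of "1 / c"] that(2) by simp
  have pow: "lam powi j \<noteq> 0" for j using lam by simp
  show "(0, shift (half k) f) \<in> N" if "(f, 0) \<in> N"
    using omega_submodule_gen[OF N that, of "Gg k"]
      cancel[OF _ pow[of k], of "(0, shift (half k) f)"]
    by (simp add: omega_scale_def shift_simps)
  show "(Y * shift (half k) h, 0) \<in> N" if "(0, h) \<in> N"
    using omega_submodule_gen[OF N that, of "Qg k"]
      cancel[OF _ pow[of "k + 1"], of "(Y * shift (half k) h, 0)"]
    by (simp add: omega_scale_def mult.assoc)
  show "((X + const2 (2 * half k) * inY beta) * shift (half k) h, 0) \<in> N" if "(0, h) \<in> N"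
    using omega_submodule_gen[OF N that, of "Gg k"]
      cancel[OF _ pow[of "k + 1"], of "((X + const2 (2 * half k) * inY beta) * shift (half k) h, 0)"]
    by (simp add: omega_scale_def shift_simps mult.assoc)
qed

text \<open>
  By \<open>shift_eq_poly\<close> the shifts \<open>f(x + p, y)\<close> are values of one polynomial in a new variable, and
  its coefficients are those of the powers of \<open>x\<close> in \<open>f\<close>.
\<close>

lemma submodule_even_coeffs:
  assumes N: "submodule N" and f: "(f, 0) \<in> N"
  shows "(0, inY (coeff f i)) \<in> N"
  using coeff_in_ideal_if_half_shifts[OF submodule_component_ideals(2)[OF N], of "map_poly inY f" i]
    submodule_shifts(1)[OF N f]
  by (simp add: coeff_map_poly_inY flip: shift_eq_poly)

text \<open>
  The second part comes from \<open>x + 2 p \<beta> = (1 - 2 \<beta>) x + 2 \<beta> (x + p)\<close>, where \<open>\<beta>\<close> may be replaced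
  by its constant term since multiples of \<open>y\<close> are covered by the first part.
\<close>

lemma submodule_odd_coeffs:
  assumes N: "submodule N" and h: "(0, h) \<in> N"
  shows "(Y * inY (coeff h i), 0) \<in> N"
    and "(const2 (1 - 2 * coeff beta 0) * X * inY (coeff h i) +
      const2 (2 * coeff beta 0) * inY (coeff (pCons 0 h) i), 0) \<in> N"
proof -
  let ?I = "{f. (f, 0) \<in> N}"
  note I = submodule_component_ideals(1)[OF N]
  have Y: "Y * inY (coeff h i) \<in> ?I" for i
  proof -
    have "coeff (Polynomial.smult Y (map_poly inY h)) i \<in> ?I"
      by (rule coeff_in_ideal_if_half_shifts[OF I])
         (use submodule_shifts(2)[OF N h] in \<open>simp flip: shift_eq_poly\<close>)
    then show ?thesis by (simp add: coeff_map_poly_inY)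
  qed
  then show "(Y * inY (coeff h i), 0) \<in> N" by simp
  have Y': "Y * inY (coeff (pCons 0 h) i) \<in> ?I" for i
    using Y self.subspace_0[OF I] by (cases i) (simp_all add: inY_simps)
  let ?b = "inY beta" and ?c = "const2 (coeff beta 0)"
  obtain c b where "beta = pCons c b" by (cases beta)
  then have b: "?b = ?c + Y * inY b" by (simp add: inY_pCons)
  let ?F = "[:(1 - 2 * ?b) * X, 2 * ?b:] * map_poly inY h"
  have two: "const2 2 = 2" using const2_of_int[of 2] by simp
  have "poly ?F (X + const2 (half k)) \<in> ?I" for k
  proof -
    have "poly ?F (X + const2 (half k)) = (X + const2 (2 * half k) * ?b) * shift (half k) h"
      by (simp add: shift_eq_poly const2_simps two algebra_simps)
    then show ?thesis using submodule_shifts(3)[OF N h] by simp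
  qed
  then have "coeff ?F i \<in> ?I" by (rule coeff_in_ideal_if_half_shifts[OF I])
  moreover have "coeff ?F i =
      (1 - 2 * ?b) * X * inY (coeff h i) + 2 * ?b * inY (coeff (pCons 0 h) i)"
    by (cases i) (simp_all add: coeff_map_poly_inY inY_simps coeff_pCons)
  moreover have "\<dots> = const2 (1 - 2 * coeff beta 0) * X * inY (coeff h i) +
      const2 (2 * coeff beta 0) * inY (coeff (pCons 0 h) i) +
      (2 * inY b * inY (coeff (pCons 0 h) i) * Y - 2 * inY b * X * (Y * inY (coeff h i)))"
    by (simp add: b const2_simps two algebra_simps)
  moreover have "2 * inY b * inY (coeff (pCons 0 h) i) * Y - 2 * inY b * X * (Y * inY (coeff h i)) \<in> ?I"
    using self.subspace_diff[OF I self.subspace_scale[OF I Y', of "2 * inY b" i]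
      self.subspace_scale[OF I Y, of "2 * inY b * X" i]] by (simp only: mult_ac)
  ultimately show "(const2 (1 - 2 * coeff beta 0) * X * inY (coeff h i) +
      const2 (2 * coeff beta 0) * inY (coeff (pCons 0 h) i), 0) \<in> N"
    using self.subspace_diff[OF I] by (metis (no_types, lifting) add_diff_cancel_right' mem_Collect_eq)
qed

text \<open>
  If the constant term of \<open>\<beta>\<close> is not zero, then \<open>h_i\<close> is congruent to a multiple of \<open>h_(i + 1)\<close>
  modulo the even component, and the coefficients above the degree vanish.
\<close>

lemma submodule_odd_coeff_in_even:
  assumes N: "submodule N" and h: "(0, h) \<in> N" and beta: "coeff beta 0 \<noteq> 0"
  shows "(inY (coeff h i), 0) \<in> N"
proof (cases "i \<le> Suc (degree h)")
  case True
  then show ?thesis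
  proof (induction i rule: inc_induct)
    case base
    show ?case
      using self.subspace_0[OF submodule_component_ideals(1)[OF N]]
      by (simp add: coeff_eq_0 inY_simps)
  next
    case (step i)
    let ?I = "{f. (f, 0) \<in> N}" and ?c = "2 * coeff beta 0"
    let ?r = "const2 (1 - ?c) * X * inY (coeff h (Suc i))"
    note I = submodule_component_ideals(1)[OF N]
    have "?r + const2 ?c * inY (coeff h i) \<in> ?I"
      using submodule_odd_coeffs(2)[OF N h, of "Suc i"] by simp
    moreover have "?r \<in> ?I" using step.IH self.subspace_scale[OF I] by simp
    ultimately have "const2 ?c * inY (coeff h i) \<in> ?I"
      using self.subspace_diff[OF I] by (metis (no_types, lifting) add_diff_cancel_left')
    then have "const2 (1 / ?c) * (const2 ?c * inY (coeff h i)) \<in> ?I"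
      by (rule self.subspace_scale[OF I])
    moreover have "const2 (1 / ?c) * (const2 ?c * inY (coeff h i)) = inY (coeff h i)"
      using beta by (simp add: mult.assoc[symmetric] flip: const2_simps(2)) (simp add: const2_simps)
    ultimately show ?case by simp
  qed
next
  case False
  then show ?thesis
    using self.subspace_0[OF submodule_component_ideals(1)[OF N]]
    by (simp add: coeff_eq_0 inY_simps)
qed

lemma submodule_X_odd_coeff_in_even:
  assumes N: "submodule N" and h: "(0, h) \<in> N"
  shows "(X * inY (coeff h i), 0) \<in> N"
proof (cases "coeff beta 0 = 0")
  case True
  then show ?thesis using submodule_odd_coeffs(2)[OF N h, of i] by (simp add: const2_simps)
next
  case False
  then show ?thesis
    using submodule_odd_coeff_in_even[OF N h]
      self.subspace_scale[OF submodule_component_ideals(1)[OF N]] by simp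
qed

text \<open>
  All coefficients of elements of a submodule \<open>N\<close> lie in the ideal \<open>(g)\<close> of those \<open>q(t)\<close> that belong
  to its odd component. So the odd component is \<open>(g)\<close>, extended to two variables, while the even one
  lies between \<open>g\<close> times the maximal ideal of the origin and the ideal generated by \<open>g\<close>, where
  there is no room for anything else.
\<close>

theorem omega_submodule_cases:
  assumes N: "submodule N"
  shows "\<exists>g. N = R_sub g \<or> N = S_sub g \<and> coeff beta 0 = 0"
proof -
  let ?E = "{f. (f, 0) \<in> N}" and ?O = "{h. (0, h) \<in> N}"
  note E = submodule_component_ideals(1)[OF N] and O = submodule_component_ideals(2)[OF N]
  have "self.subspace {q. inY q \<in> ?O}"
    using O unfolding self.subspace_def by (auto simp: inY_simps)
  then obtain g where "{q. inY q \<in> ?O} = {q. g dvd q}" using principal_ideal_poly by blast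
  then have g: "inY q \<in> ?O \<longleftrightarrow> g dvd q" for q by blast
  have gO: "inY g * h \<in> ?O" for h
    using self.subspace_scale[OF O, of "inY g" h] g[of g] by (simp add: mult.commute)
  have mult_g: "\<exists>h'. h = inY g * h'" if "\<And>i. g dvd coeff h i" for h :: poly2
    using that const_poly_dvd_iff[of g h] by (metis inY_def dvd_def)
  have O_mult: "\<exists>h'. h = inY g * h'" if h: "(0, h) \<in> N" for h
  proof (rule mult_g)
    fix i
    have "((X * inY (coeff h i)), 0) \<in> N" by (rule submodule_X_odd_coeff_in_even[OF N h])
    from submodule_even_coeffs[OF N this, of 1]
    show "g dvd coeff h i" using g by (simp add: X_def inY_def)
  qed
  have E_mult: "\<exists>f'. f = inY g * f'" if "(f, 0) \<in> N" for f
    using submodule_even_coeffs[OF N that] g by (intro mult_g) simp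
  have N_eq: "(f, h) \<in> N \<longleftrightarrow> (f, 0) \<in> N \<and> (0, h) \<in> N" for f h
  proof (intro iffI conjI)
    assume "(f, 0) \<in> N \<and> (0, h) \<in> N"
    then have "(f, 0) + (0, h) \<in> N"
      using N unfolding submodule_def by (meson omega.subspace_add)
    then show "(f, h) \<in> N" by simp
  qed (use omega_submodule_components[OF N] in blast)+
  have N_mult: "\<exists>f' h'. v = (inY g * f', inY g * h')" if "v \<in> N" for v
    using that E_mult O_mult N_eq by (cases v) blast
  have X: "inY g * X \<in> ?E" and Y: "inY g * Y \<in> ?E"
    using submodule_X_odd_coeff_in_even[OF N, of "inY g" 0]
      submodule_odd_coeffs(1)[OF N, of "inY g" 0] gO[of 1]
    by (simp_all add: inY_def mult.commute)
  show ?thesis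
  proof (cases "inY g \<in> ?E")
    case True
    then have gE: "inY g * f \<in> ?E" for f
      using self.subspace_scale[OF E, of "inY g" f] by (simp add: mult.commute)
    have "N = R_sub g"
    proof (intro equalityI subsetI)
      show "v \<in> R_sub g" if "v \<in> N" for v
        using N_mult[OF that] unfolding R_sub_def by blast
      show "v \<in> N" if "v \<in> R_sub g" for v
        using that gE gO N_eq unfolding R_sub_def by blast
    qed
    then show ?thesis by blast
  next
    case False
    have XY: "inY g * (X * f1 + Y * f2) \<in> ?E" for f1 f2
      using self.subspace_add[OF E self.subspace_scale[OF E X, of f1] self.subspace_scale[OF E Y, of f2]]
      by (simp add: algebra_simps)
    have const: "const_term f = 0" if f: "inY g * f \<in> ?E" for f
    proof (rule ccontr)
      assume c: "const_term f \<noteq> 0"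
      obtain f1 f2 where f12: "f = const2 (const_term f) + X * f1 + Y * f2"
        using const_term_decomp by blast
      have "inY g * f - inY g * (X * f1 + Y * f2) \<in> ?E"
        by (rule self.subspace_diff[OF E f XY])
      moreover have "inY g * f - inY g * (X * f1 + Y * f2) = const2 (const_term f) * inY g"
        by (subst f12) (simp add: algebra_simps)
      ultimately have "const2 (1 / const_term f) * (const2 (const_term f) * inY g) \<in> ?E"
        using self.subspace_scale[OF E] by metis
      moreover have "const2 (1 / const_term f) * (const2 (const_term f) * inY g) = inY g"
        using c by (simp add: mult.assoc[symmetric] flip: const2_simps(2)) (simp add: const2_simps)
      ultimately show False using False by simp
    qed
    have "coeff beta 0 = 0"
      using False gO[of 1] submodule_odd_coeff_in_even[OF N, of "inY g" 0] by (auto simp: inY_def)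
    moreover have "N = S_sub g"
    proof (intro equalityI subsetI)
      fix v assume "v \<in> N"
      then obtain f h where "v = (inY g * f, inY g * h)" "inY g * f \<in> ?E"
        using N_mult N_eq by blast
      then show "v \<in> S_sub g" using const mem_S_sub_iff by blast
    next
      fix v assume "v \<in> S_sub g"
      then show "v \<in> N" using XY gO N_eq unfolding S_sub_def by blast
    qed
    ultimately show ?thesis by blast
  qed
qed

text \<open>
  Every \<open>g\<close> that is not a unit has a root \<open>z\<close>, also if \<open>g = 0\<close>, and then \<open>R_sub g\<close> and
  \<open>S_sub g\<close> lie in the proper submodule of \<open>y - z\<close>. If \<open>g\<close> is a unit, then \<open>R_sub g\<close> is everything
  and only \<open>S_sub g\<close> remains.
\<close>

lemma maximal_submodule_cases:
  assumes M: "maximal_submodule M"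
  shows "(\<exists>g. degree g = 1 \<and> M = R_sub g) \<or> coeff beta 0 = 0 \<and> M = S_sub 1"
proof -
  have proper: "M \<noteq> UNIV" and max: "\<And>N. submodule N \<Longrightarrow> M \<subseteq> N \<Longrightarrow> N = M \<or> N = UNIV"
    and "submodule M"
    using M unfolding maximal_submodule_def by blast+
  then obtain g where g: "M = R_sub g \<or> M = S_sub g \<and> coeff beta 0 = 0"
    using omega_submodule_cases by blast
  show ?thesis
  proof (cases "g dvd 1")
    case True
    then have "M = S_sub g" "coeff beta 0 = 0" using g proper R_sub_eq_UNIV_iff by auto
    moreover have "S_sub g = S_sub 1"
    proof (intro equalityI subsetI)
      fix v assume "v \<in> S_sub g"
      then show "v \<in> S_sub 1" by (auto simp: mem_S_sub_iff S_sub_one const_term_simps)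
    next
      obtain g' where g': "1 = g * g'" using True by (elim dvdE)
      then have unit: "inY g * (inY g' * f) = f" for f
        by (metis inY_simps(3,5) mult.assoc mult_1)
      fix v assume "v \<in> S_sub 1"
      then have "const_term (inY g' * fst v) = 0"
        "v = (inY g * (inY g' * fst v), inY g * (inY g' * snd v))"
        by (simp_all add: S_sub_one const_term_simps unit)
      then show "v \<in> S_sub g" unfolding mem_S_sub_iff by blast
    qed
    ultimately show ?thesis by blast
  next
    case False
    then obtain z where "R_sub g \<subseteq> R_sub [:- z, 1:]" using R_sub_linear_above by blast
    then have "M \<subseteq> R_sub [:- z, 1:]" using g S_sub_subset_R_sub by blast
    moreover have "R_sub [:- z, 1:] \<noteq> UNIV"
      by (simp add: R_sub_eq_UNIV_iff is_unit_iff_degree)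
    ultimately have "M = R_sub [:- z, 1:]" using max submodule_R_sub by blast
    then show ?thesis by (intro disjI1 exI[of _ "[:- z, 1:]"]) simp
  qed
qed

end


section \<open>Quotients of modules and bases\<close>

context Module.module
begin

lemma abelian_subgroup_submodule:
  assumes "submodule N R M"
  shows "abelian_subgroup N M"
proof -
  interpret N: submodule N R M by (rule assms)
  have "additive_subgroup N M" by (intro additive_subgroup.intro N.subgroup_axioms)
  then show ?thesis by (rule abelian_subgroupI3) (rule M.abelian_group_axioms)
qed

lemma quot_module_sel:
  "carrier (quot_module M N) = (\<lambda>x. N +>\<^bsub>M\<^esub> x) ` carrier M"
  "zero (quot_module M N) = N" "add (quot_module M N) = set_add M"
  "smult (quot_module M N) r K = (\<Union>v\<in>K. N +>\<^bsub>M\<^esub> (r \<odot>\<^bsub>M\<^esub> v))"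
  by (auto simp: quot_module_def A_RCOSETS_def')

lemma quot_module_add:
  assumes "submodule N R M" "x \<in> carrier M" "y \<in> carrier M"
  shows "(N +>\<^bsub>M\<^esub> x) \<oplus>\<^bsub>quot_module M N\<^esub> (N +>\<^bsub>M\<^esub> y) = N +>\<^bsub>M\<^esub> (x \<oplus>\<^bsub>M\<^esub> y)"
  unfolding quot_module_sel
  by (rule abelian_subgroup.a_rcos_sum[OF abelian_subgroup_submodule]) fact+

text \<open>
  The union that defines the scalar multiplication is over equal sets: if \<open>h\<close> is in \<open>N\<close>, then
  so is \<open>r \<odot> h\<close>.
\<close>

lemma quot_module_smult:
  assumes N: "submodule N R M" and r: "r \<in> carrier R" and x: "x \<in> carrier M"
  shows "r \<odot>\<^bsub>quot_module M N\<^esub> (N +>\<^bsub>M\<^esub> x) = N +>\<^bsub>M\<^esub> (r \<odot>\<^bsub>M\<^esub> x)"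
proof -
  interpret N: submodule N R M by (rule N)
  interpret ab: abelian_subgroup N M by (rule abelian_subgroup_submodule[OF N])
  have eq: "N +>\<^bsub>M\<^esub> (r \<odot>\<^bsub>M\<^esub> v) = N +>\<^bsub>M\<^esub> (r \<odot>\<^bsub>M\<^esub> x)" if v: "v \<in> N +>\<^bsub>M\<^esub> x" for v
  proof -
    obtain h where h: "h \<in> N" "v = h \<oplus>\<^bsub>M\<^esub> x" using v by (auto simp: a_r_coset_def')
    have hM: "h \<in> carrier M" using h(1) by (rule ab.a_Hcarr)
    have "N +>\<^bsub>M\<^esub> (r \<odot>\<^bsub>M\<^esub> v) = (N +>\<^bsub>M\<^esub> (r \<odot>\<^bsub>M\<^esub> h)) <+>\<^bsub>M\<^esub> (N +>\<^bsub>M\<^esub> (r \<odot>\<^bsub>M\<^esub> x))"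
      using r x hM by (simp add: h(2) smult_r_distr ab.a_rcos_sum)
    also have "N +>\<^bsub>M\<^esub> (r \<odot>\<^bsub>M\<^esub> h) = N"
      by (intro ab.a_rcos_const N.smult_closed r h)
    also have "N <+>\<^bsub>M\<^esub> (N +>\<^bsub>M\<^esub> (r \<odot>\<^bsub>M\<^esub> x)) = N +>\<^bsub>M\<^esub> (r \<odot>\<^bsub>M\<^esub> x)"
      by (intro ab.rcosets_add_eq a_rcosetsI ab.a_subset smult_closed r x)
    finally show ?thesis .
  qed
  have "x \<in> N +>\<^bsub>M\<^esub> x" using x by (rule ab.a_rcos_self)
  then show ?thesis unfolding quot_module_sel using eq by blast
qed

lemma module_quot_module:
  assumes N: "submodule N R M"
  shows "Module.module R (quot_module M N)"
proof (rule moduleI)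
  interpret ab: abelian_subgroup N M by (rule abelian_subgroup_submodule[OF N])
  let ?Q = "quot_module M N"
  show "cring R" by (rule R.cring_axioms)
  have zero: "\<zero>\<^bsub>?Q\<^esub> = N +>\<^bsub>M\<^esub> \<zero>\<^bsub>M\<^esub>"
    by (simp add: quot_module_sel(2) ab.a_rcos_const)
  show "abelian_group ?Q"
  proof (rule abelian_groupI)
    fix K assume "K \<in> carrier ?Q"
    then obtain x where x: "x \<in> carrier M" "K = N +>\<^bsub>M\<^esub> x" by (auto simp: quot_module_sel(1))
    then show "\<exists>K'\<in>carrier ?Q. K' \<oplus>\<^bsub>?Q\<^esub> K = \<zero>\<^bsub>?Q\<^esub>"
      by (intro bexI[of _ "N +>\<^bsub>M\<^esub> (\<ominus>\<^bsub>M\<^esub> x)"])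
         (simp_all add: zero quot_module_add[OF N] M.l_neg quot_module_sel(1))
  qed (auto simp: zero quot_module_sel(1) quot_module_add[OF N] M.a_ac)
qed (auto simp: quot_module_sel(1) quot_module_add[OF N] quot_module_smult[OF N]
    smult_l_distr smult_r_distr smult_assoc1)

lemma quot_module_finsum:
  assumes N: "submodule N R M" and I: "finite I" and w: "w \<in> I \<rightarrow> carrier M"
  shows "(\<Oplus>\<^bsub>quot_module M N\<^esub>i\<in>I. N +>\<^bsub>M\<^esub> w i) = N +>\<^bsub>M\<^esub> (\<Oplus>\<^bsub>M\<^esub>i\<in>I. w i)"
  using I w
proof (induction I rule: finite_induct)
  case empty
  interpret Q: Module.module R "quot_module M N" by (rule module_quot_module[OF N])
  interpret ab: abelian_subgroup N M by (rule abelian_subgroup_submodule[OF N])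
  show ?case by (simp add: quot_module_sel ab.a_rcos_const)
next
  case (insert i I)
  interpret Q: Module.module R "quot_module M N" by (rule module_quot_module[OF N])
  have "(\<Oplus>\<^bsub>quot_module M N\<^esub>j\<in>insert i I. N +>\<^bsub>M\<^esub> w j) =
      (N +>\<^bsub>M\<^esub> w i) \<oplus>\<^bsub>quot_module M N\<^esub> (\<Oplus>\<^bsub>quot_module M N\<^esub>j\<in>I. N +>\<^bsub>M\<^esub> w j)"
    using insert by (intro Q.finsum_insert) (auto simp: quot_module_sel(1))
  also have "(\<Oplus>\<^bsub>quot_module M N\<^esub>j\<in>I. N +>\<^bsub>M\<^esub> w j) = N +>\<^bsub>M\<^esub> (\<Oplus>\<^bsub>M\<^esub>j\<in>I. w j)"
    using insert by simp
  also have "(N +>\<^bsub>M\<^esub> w i) \<oplus>\<^bsub>quot_module M N\<^esub> (N +>\<^bsub>M\<^esub> (\<Oplus>\<^bsub>M\<^esub>j\<in>I. w j)) =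
      N +>\<^bsub>M\<^esub> (\<Oplus>\<^bsub>M\<^esub>j\<in>insert i I. w j)"
    using insert by (simp add: quot_module_add[OF N] Pi_def)
  finally show ?case .
qed

text \<open>
  A basis given as a family is injective by the uniqueness of coordinates, since \<open>1 \<noteq> 0\<close> in the ring;
  this turns it into a basis given as a set.
\<close>

lemma free_module_of_rank_family:
  assumes I: "finite I" and e: "e \<in> I \<rightarrow> carrier M" and nontriv: "\<one> \<noteq> \<zero>"
    and ex: "\<And>x. x \<in> carrier M \<Longrightarrow> \<exists>c \<in> I \<rightarrow> carrier R. x = (\<Oplus>\<^bsub>M\<^esub>i\<in>I. c i \<odot>\<^bsub>M\<^esub> e i)"
    and uniq: "\<And>c d. c \<in> I \<rightarrow> carrier R \<Longrightarrow> d \<in> I \<rightarrow> carrier R \<Longrightarrow>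
      (\<Oplus>\<^bsub>M\<^esub>i\<in>I. c i \<odot>\<^bsub>M\<^esub> e i) = (\<Oplus>\<^bsub>M\<^esub>i\<in>I. d i \<odot>\<^bsub>M\<^esub> e i) \<Longrightarrow> \<forall>i\<in>I. c i = d i"
  shows "free_module_of_rank R M (card I)"
proof -
  have inj: "inj_on e I"
  proof (rule inj_onI)
    fix i j assume ij: "i \<in> I" "j \<in> I" "e i = e j"
    let ?\<delta> = "\<lambda>k l. if k = l then \<one> else \<zero>"
    have \<delta>: "(\<Oplus>\<^bsub>M\<^esub>l\<in>I. ?\<delta> k l \<odot>\<^bsub>M\<^esub> e l) = e k" if "k \<in> I" for k
    proof -
      have "(\<Oplus>\<^bsub>M\<^esub>l\<in>I. ?\<delta> k l \<odot>\<^bsub>M\<^esub> e l) = (\<Oplus>\<^bsub>M\<^esub>l\<in>I. if k = l then e l else \<zero>\<^bsub>M\<^esub>)"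
        using funcset_mem[OF e] by (intro M.finsum_cong') auto
      also have "\<dots> = e k" using that I e by (rule M.finsum_singleton)
      finally show ?thesis .
    qed
    have "\<forall>l\<in>I. ?\<delta> i l = ?\<delta> j l"
      by (rule uniq) (auto simp: \<delta> ij)
    then show "i = j" using ij(1) nontriv by (metis (full_types))
  qed
  have reindex: "(\<Oplus>\<^bsub>M\<^esub>b\<in>e ` I. c b \<odot>\<^bsub>M\<^esub> b) = (\<Oplus>\<^bsub>M\<^esub>i\<in>I. c (e i) \<odot>\<^bsub>M\<^esub> e i)"
    if "c \<in> e ` I \<rightarrow> carrier R" for c
    using funcset_mem[OF that] funcset_mem[OF e] by (intro M.finsum_reindex inj) auto
  have "\<exists>!c. c \<in> e ` I \<rightarrow>\<^sub>E carrier R \<and> x = (\<Oplus>\<^bsub>M\<^esub>b\<in>e ` I. c b \<odot>\<^bsub>M\<^esub> b)"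
    if x: "x \<in> carrier M" for x
  proof (rule ex_ex1I)
    obtain d where d: "d \<in> I \<rightarrow> carrier R" "x = (\<Oplus>\<^bsub>M\<^esub>i\<in>I. d i \<odot>\<^bsub>M\<^esub> e i)" using ex[OF x] by blast
    let ?c = "restrict (\<lambda>b. d (inv_into I e b)) (e ` I)"
    have c: "?c \<in> e ` I \<rightarrow>\<^sub>E carrier R" using d(1) inj by (auto simp: inv_into_f_f)
    have "x = (\<Oplus>\<^bsub>M\<^esub>i\<in>I. ?c (e i) \<odot>\<^bsub>M\<^esub> e i)"
      unfolding d(2) using funcset_mem[OF d(1)] funcset_mem[OF e] inj
      by (intro M.finsum_cong') (auto simp: inv_into_f_f)
    also have "\<dots> = (\<Oplus>\<^bsub>M\<^esub>b\<in>e ` I. ?c b \<odot>\<^bsub>M\<^esub> b)"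
      using c by (intro reindex[symmetric]) auto
    finally show "\<exists>c. c \<in> e ` I \<rightarrow>\<^sub>E carrier R \<and> x = (\<Oplus>\<^bsub>M\<^esub>b\<in>e ` I. c b \<odot>\<^bsub>M\<^esub> b)" using c by blast
  next
    fix c d
    assume "c \<in> e ` I \<rightarrow>\<^sub>E carrier R \<and> x = (\<Oplus>\<^bsub>M\<^esub>b\<in>e ` I. c b \<odot>\<^bsub>M\<^esub> b)"
      and "d \<in> e ` I \<rightarrow>\<^sub>E carrier R \<and> x = (\<Oplus>\<^bsub>M\<^esub>b\<in>e ` I. d b \<odot>\<^bsub>M\<^esub> b)"
    then have c: "c \<in> e ` I \<rightarrow>\<^sub>E carrier R" and d: "d \<in> e ` I \<rightarrow>\<^sub>E carrier R"
      and eq: "(\<Oplus>\<^bsub>M\<^esub>b\<in>e ` I. c b \<odot>\<^bsub>M\<^esub> b) = (\<Oplus>\<^bsub>M\<^esub>b\<in>e ` I. d b \<odot>\<^bsub>M\<^esub> b)" by simp_all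
    have c': "c \<in> e ` I \<rightarrow> carrier R" and d': "d \<in> e ` I \<rightarrow> carrier R" using c d by auto
    have "\<forall>i\<in>I. c (e i) = d (e i)"
      by (rule uniq[of "\<lambda>i. c (e i)" "\<lambda>i. d (e i)"])
         (use c' d' eq in \<open>auto simp: reindex[OF c'] reindex[OF d']\<close>)
    then show "c = d" using c d by (intro PiE_ext) auto
  qed
  then show ?thesis
    unfolding free_module_of_rank_def
    using e I by (intro conjI module_axioms exI[of _ "e ` I"]) (auto simp: card_image[OF inj])
qed

end


section \<open>Omega as a module over the polynomials in \<open>L_0\<close>\<close>

definition inX :: "complex poly \<Rightarrow> poly2"
  where "inX p = map_poly (\<lambda>c. [:c:]) p"

lemma coeff_inX: "coeff (inX p) i = [:coeff p i:]"
  by (simp add: inX_def coeff_map_poly)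

lemma inX_pCons: "inX (pCons c p) = const2 c + X * inX p"
  by (simp add: inX_def map_poly_pCons const2_def X_def)

lemma inX_0: "inX 0 = 0" and inX_1: "inX 1 = 1"
  by (simp_all add: inX_def)

lemma inX_add: "inX (p + q) = inX p + inX q"
  by (rule poly_eqI) (simp add: coeff_inX)

lemma inX_diff: "inX (p - q) = inX p - inX q"
  by (rule poly_eqI) (simp add: coeff_inX)

lemma inX_smult: "inX (Polynomial.smult c p) = const2 c * inX p"
  by (rule poly_eqI) (simp add: coeff_inX const2_def)

lemma inX_mult: "inX (p * q) = inX p * inX q"
proof (induction p)
  case 0
  show ?case by (simp add: inX_0)
next
  case (pCons c p)
  have "inX (pCons c p * q) = inX (Polynomial.smult c q + pCons 0 (p * q))" by simp
  also have "\<dots> = inX (pCons c p) * inX q"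
    by (simp only: inX_add inX_smult inX_pCons pCons.IH const2_simps distrib_right mult.assoc add_0_left)
  finally show ?case .
qed

lemma inX_eq_sum: "inX p = (\<Sum>i\<le>degree p. const2 (coeff p i) * X ^ i)"
proof -
  have "X ^ i = monom 1 i" for i by (simp add: X_def monom_altdef)
  then have "const2 (coeff p i) * X ^ i = monom [:coeff p i:] i" for i
    by (simp add: const2_def smult_monom)
  then show ?thesis
    by (intro poly_eqI) (simp add: coeff_inX coeff_sum coeff_eq_0)
qed

text \<open>
  For \<open>m = 0\<close> both the shift and the multiple of \<open>\<beta>\<close> disappear from the action of \<open>L_m\<close>, so \<open>L_0\<close>
  is multiplication by \<open>X\<close>.
\<close>

lemma omega_L0_module_sel:
  "carrier (omega_L0_module lam beta) = UNIV" "zero (omega_L0_module lam beta) = 0"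
  "add (omega_L0_module lam beta) = (+)"
  "smult (omega_L0_module lam beta) p v = (inX p * fst v, inX p * snd v)"
proof -
  let ?L = "omega_act lam beta (bas (Lg 0) 1)"
  have "shift 0 f = f" for f
    by (simp add: shift_def const2_simps X_def pcompose_idR)
  then have L: "?L v = (X * fst v, X * snd v)" for v
    by (cases v) (simp add: omega_act_single const2_simps)
  have "(?L ^^ i) v = (X ^ i * fst v, X ^ i * snd v)" for i
    by (induction i) (simp_all add: L mult.assoc)
  then show "smult (omega_L0_module lam beta) p v = (inX p * fst v, inX p * snd v)"
    by (simp add: omega_L0_module_def operator_module_def omega_scale_def inX_eq_sum prod_eq_iff
        fst_sum snd_sum sum_distrib_right mult.assoc)
qed (simp_all add: omega_L0_module_def operator_module_def)

lemma cpoly_ring_sel: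
  "carrier cpoly_ring = UNIV" "mult cpoly_ring = (*)" "one cpoly_ring = 1"
  "zero cpoly_ring = 0" "add cpoly_ring = (+)"
  by (simp_all add: cpoly_ring_def)

lemma cring_cpoly_ring: "cring cpoly_ring"
proof (rule cringI)
  show "abelian_group cpoly_ring"
  proof (rule abelian_groupI)
    show "\<exists>y\<in>carrier cpoly_ring. y \<oplus>\<^bsub>cpoly_ring\<^esub> x = \<zero>\<^bsub>cpoly_ring\<^esub>" for x
      by (rule bexI[of _ "- x"]) (simp_all add: cpoly_ring_sel)
  qed (simp_all add: cpoly_ring_sel ac_simps)
  show "Group.comm_monoid cpoly_ring"
    by (rule comm_monoidI) (simp_all add: cpoly_ring_sel ac_simps)
qed (simp add: cpoly_ring_sel distrib_right)

lemma module_omega_L0_module: "Module.module cpoly_ring (omega_L0_module lam beta)"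
proof (rule moduleI[OF cring_cpoly_ring])
  show "abelian_group (omega_L0_module lam beta)"
  proof (rule abelian_groupI)
    show "\<exists>y\<in>carrier (omega_L0_module lam beta).
        y \<oplus>\<^bsub>omega_L0_module lam beta\<^esub> x = \<zero>\<^bsub>omega_L0_module lam beta\<^esub>" for x
      by (rule bexI[of _ "- x"]) (simp_all add: omega_L0_module_sel)
  qed (simp_all add: omega_L0_module_sel ac_simps)
qed (simp_all add: omega_L0_module_sel cpoly_ring_sel inX_add inX_mult inX_1
      distrib_left distrib_right mult.assoc)

lemma mem_R_sub_iff: "v \<in> R_sub g \<longleftrightarrow> inY g dvd fst v \<and> inY g dvd snd v"
  unfolding R_sub_def dvd_def by (cases v) auto

lemma submodule_L0_R_sub: "submodule (R_sub g) cpoly_ring (omega_L0_module lam beta)"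
proof -
  interpret Module.module cpoly_ring "omega_L0_module lam beta"
    by (rule module_omega_L0_module)
  have minus: "\<ominus>\<^bsub>omega_L0_module lam beta\<^esub> v = - v" for v
    by (rule M.minus_equality) (simp_all add: omega_L0_module_sel)
  show ?thesis
    by (rule submoduleI) (simp_all add: omega_L0_module_sel minus mem_R_sub_iff)
qed

lemma omega_L0_coset_eq_iff:
  "R_sub g +>\<^bsub>omega_L0_module lam beta\<^esub> v = R_sub g +>\<^bsub>omega_L0_module lam beta\<^esub> w \<longleftrightarrow>
    v - w \<in> R_sub g"
proof -
  have coset: "R_sub g +>\<^bsub>omega_L0_module lam beta\<^esub> v = {u. u - v \<in> R_sub g}" for v
    unfolding a_r_coset_def' omega_L0_module_sel
    by (auto simp: algebra_simps intro: bexI[of _ "_ - v"])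
  have "v \<in> {u. u - v \<in> R_sub g}" by (simp add: mem_R_sub_iff)
  moreover have "u - v \<in> R_sub g \<longleftrightarrow> u - w \<in> R_sub g" if "v - w \<in> R_sub g" for u
  proof -
    have "u - w = (u - v) + (v - w)" by simp
    then have "fst (u - w) = fst (u - v) + fst (v - w)" "snd (u - w) = snd (u - v) + snd (v - w)"
      by (simp_all only: fst_add snd_add)
    then show ?thesis
      using that unfolding mem_R_sub_iff by (simp only: dvd_add_left_iff)
  qed
  ultimately show ?thesis unfolding coset by blast
qed

lemma omega_L0_finsum:
  assumes "finite I"
  shows "finsum (omega_L0_module lam beta) w I = sum w I"
  using assms
proof (induction I rule: finite_induct)
  interpret Module.module cpoly_ring "omega_L0_module lam beta"
    by (rule module_omega_L0_module)
  case empty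
  show ?case by (simp add: omega_L0_module_sel)
next
  interpret Module.module cpoly_ring "omega_L0_module lam beta"
    by (rule module_omega_L0_module)
  case (insert i I)
  then show ?case by (simp add: omega_L0_module_sel)
qed

text \<open>
  Division by \<open>g(y)\<close> of the coefficients of the powers of \<open>x\<close>: modulo \<open>g(y)\<close>, every polynomial is
  uniquely a combination of \<open>1, y, ..., y^(deg g - 1)\<close> over the polynomials in \<open>x\<close>.
\<close>

definition Y_comb :: "nat \<Rightarrow> (nat \<Rightarrow> complex poly) \<Rightarrow> poly2"
  where "Y_comb n c = (\<Sum>j<n. inX (c j) * Y ^ j)"

lemma coeff_Y_comb: "coeff (Y_comb n c) i = (\<Sum>j<n. monom (coeff (c j) i) j)"
proof -
  have "Y ^ j = [:monom 1 j:]" for j :: nat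
  proof (induction j)
    case 0
    show ?case by (simp add: monom_0 flip: one_pCons)
  next
    case (Suc j)
    then show ?case by (simp add: Y_def monom_Suc)
  qed
  then have "inX (c j) * Y ^ j = Polynomial.smult (monom 1 j) (inX (c j))" for j
    by simp
  then show ?thesis by (simp add: Y_comb_def coeff_sum coeff_inX mult.commute smult_monom)
qed

lemma coeff_sum_monom_lessThan:
  "coeff (\<Sum>j<n. monom (a j) j) k = (if k < n then a k else 0)"
  by (simp add: coeff_sum)

lemma Y_comb_diff: "Y_comb n c - Y_comb n d = Y_comb n (\<lambda>j. c j - d j)"
  by (simp add: Y_comb_def inX_diff left_diff_distrib sum_subtractf)

lemma Y_comb_exists:
  assumes "g \<noteq> 0"
  shows "\<exists>c. inY g dvd f - Y_comb (degree g) c"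
proof -
  define c where "c j = map_poly (\<lambda>q. coeff (q mod g) j) f" for j
  have "coeff (Y_comb (degree g) c) i = coeff f i mod g" for i
  proof (rule poly_eqI)
    fix k
    have "k \<ge> degree g \<Longrightarrow> coeff (coeff f i mod g) k = 0"
      using degree_mod_less[OF assms, of "coeff f i"] by (auto intro: coeff_eq_0)
    then show "coeff (coeff (Y_comb (degree g) c) i) k = coeff (coeff f i mod g) k"
      by (simp add: coeff_Y_comb coeff_sum_monom_lessThan c_def coeff_map_poly)
  qed
  then have "inY g dvd f - Y_comb (degree g) c"
    by (simp add: inY_def const_poly_dvd_iff dvd_minus_mod)
  then show ?thesis by blast
qed

lemma Y_comb_unique:
  assumes dvd: "inY g dvd Y_comb (degree g) c" and j: "j < degree g"
  shows "c j = 0"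
proof (rule poly_eqI)
  fix i
  let ?r = "\<Sum>j<degree g. monom (coeff (c j) i) j"
  have "g dvd ?r" using dvd by (simp add: inY_def const_poly_dvd_iff coeff_Y_comb)
  moreover have "degree ?r < degree g"
    using j by (intro degree_lessI) (auto simp: coeff_sum_monom_lessThan)
  ultimately have "?r = 0" using dvd_imp_degree_le[of g ?r] by linarith
  then show "coeff (c j) i = coeff 0 i"
    using coeff_sum_monom_lessThan[of "\<lambda>j. coeff (c j) i" "degree g" j] j by simp
qed

definition omega_basis :: "nat \<times> bool \<Rightarrow> omega"
  where "omega_basis i = (if snd i then (0, Y ^ fst i) else (Y ^ fst i, 0))"

lemma omega_L0_comb:
  "(\<Sum>i\<in>{..<n} \<times> UNIV. c i \<odot>\<^bsub>omega_L0_module lam beta\<^esub> omega_basis i) =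
    (Y_comb n (\<lambda>j. c (j, False)), Y_comb n (\<lambda>j. c (j, True)))"
  by (simp add: sum.cartesian_product' UNIV_bool omega_L0_module_sel omega_basis_def
      Y_comb_def prod_eq_iff fst_sum snd_sum)

theorem free_quotient_R_sub:
  assumes g: "g \<noteq> 0"
  shows "free_module_of_rank cpoly_ring (quot_module (omega_L0_module lam beta) (R_sub g))
    (2 * degree g)"
proof -
  let ?M = "omega_L0_module lam beta" and ?I = "{..<degree g} \<times> (UNIV :: bool set)"
  let ?Q = "quot_module ?M (R_sub g)" and ?cl = "\<lambda>v. R_sub g +>\<^bsub>omega_L0_module lam beta\<^esub> v"
  interpret M: Module.module cpoly_ring ?M by (rule module_omega_L0_module)
  note N = submodule_L0_R_sub[of g lam beta]
  interpret Q: Module.module cpoly_ring ?Q by (rule M.module_quot_module[OF N])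
  have comb: "(\<Oplus>\<^bsub>?Q\<^esub>i\<in>?I. c i \<odot>\<^bsub>?Q\<^esub> ?cl (omega_basis i)) =
      ?cl (Y_comb (degree g) (\<lambda>j. c (j, False)), Y_comb (degree g) (\<lambda>j. c (j, True)))" for c
  proof -
    have "(\<Oplus>\<^bsub>?Q\<^esub>i\<in>?I. c i \<odot>\<^bsub>?Q\<^esub> ?cl (omega_basis i)) =
        (\<Oplus>\<^bsub>?Q\<^esub>i\<in>?I. ?cl (c i \<odot>\<^bsub>?M\<^esub> omega_basis i))"
      by (simp add: M.quot_module_smult[OF N] cpoly_ring_sel omega_L0_module_sel(1))
    also have "\<dots> = ?cl (\<Sum>i\<in>?I. c i \<odot>\<^bsub>?M\<^esub> omega_basis i)"
      by (subst M.quot_module_finsum[OF N]) (auto simp: omega_L0_finsum omega_L0_module_sel(1))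
    finally show ?thesis by (simp only: omega_L0_comb)
  qed
  have "free_module_of_rank cpoly_ring ?Q (card ?I)"
  proof (rule Q.free_module_of_rank_family[of _ "\<lambda>i. ?cl (omega_basis i)"])
    show "(\<lambda>i. ?cl (omega_basis i)) \<in> ?I \<rightarrow> carrier ?Q"
      by (simp add: M.quot_module_sel(1) omega_L0_module_sel(1))
    show "\<one>\<^bsub>cpoly_ring\<^esub> \<noteq> \<zero>\<^bsub>cpoly_ring\<^esub>" by (simp add: cpoly_ring_sel)
  next
    fix x assume "x \<in> carrier ?Q"
    then obtain v where x: "x = ?cl v" by (auto simp: M.quot_module_sel(1))
    obtain c d where "inY g dvd fst v - Y_comb (degree g) c" "inY g dvd snd v - Y_comb (degree g) d"
      using Y_comb_exists[OF g] by meson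
    then have "x = ?cl (Y_comb (degree g) c, Y_comb (degree g) d)"
      unfolding x omega_L0_coset_eq_iff by (simp add: mem_R_sub_iff)
    then show "\<exists>c\<in>?I \<rightarrow> carrier cpoly_ring. x = (\<Oplus>\<^bsub>?Q\<^esub>i\<in>?I. c i \<odot>\<^bsub>?Q\<^esub> ?cl (omega_basis i))"
      by (intro bexI[of _ "\<lambda>(j, b). if b then d j else c j"])
         (simp_all only: comb, simp_all add: cpoly_ring_sel)
  next
    fix c d
    assume "(\<Oplus>\<^bsub>?Q\<^esub>i\<in>?I. c i \<odot>\<^bsub>?Q\<^esub> ?cl (omega_basis i)) =
      (\<Oplus>\<^bsub>?Q\<^esub>i\<in>?I. d i \<odot>\<^bsub>?Q\<^esub> ?cl (omega_basis i))"
    then have "inY g dvd Y_comb (degree g) (\<lambda>j. c (j, b) - d (j, b))" for b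
      unfolding comb omega_L0_coset_eq_iff by (cases b) (simp_all add: mem_R_sub_iff Y_comb_diff)
    then have "c (j, b) - d (j, b) = 0" if "j < degree g" for j b
      using Y_comb_unique that by blast
    then show "\<forall>i\<in>?I. c i = d i" by auto
  qed simp
  moreover have "card ?I = 2 * degree g" by (simp add: card_cartesian_product)
  ultimately show ?thesis by simp
qed


section \<open>The submodule lattice and the quotients of Omega\<close>

theorem theorem4p3:
  fixes lam :: complex and beta :: "complex poly"
  assumes "lam \<noteq> 0"
  shows
    "(coeff beta 0 \<noteq> 0 \<longrightarrow>
        {N. omega_submodule lam beta N} = {R_sub g | g. True} \<and>
        (\<forall>g g'. g' dvd g \<longrightarrow> R_sub g \<subseteq> R_sub g'))
     \<and> (coeff beta 0 = 0 \<longrightarrow>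
        {N. omega_submodule lam beta N} = {R_sub g | g. True} \<union> {S_sub g | g. True} \<and>
        (\<forall>g g'. g' dvd g \<longrightarrow> S_sub g \<subseteq> R_sub g \<and> R_sub g \<subseteq> R_sub g'))
     \<and> (\<forall>g. g \<noteq> 0 \<longrightarrow>
        free_module_of_rank cpoly_ring
          (quot_module (omega_L0_module lam beta) (R_sub g)) (2 * degree g))
     \<and> (\<forall>M. omega_maximal_submodule lam beta M \<longrightarrow>
        (\<exists>g. degree g = 1 \<and> M = R_sub g) \<or> (coeff beta 0 = 0 \<and> M = S_sub 1))"
proof (intro conjI impI allI)
  interpret hv_module omega_scale omega_part "omega_act lam beta"
    by (rule omega_hv_module[OF assms])
  show "{N. omega_submodule lam beta N} = {R_sub g | g. True}" if "coeff beta 0 \<noteq> 0"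
    using that omega_submodule_cases[OF assms, of beta] submodule_R_sub[OF assms, of beta] by blast
  show "{N. omega_submodule lam beta N} = {R_sub g | g. True} \<union> {S_sub g | g. True}"
    if "coeff beta 0 = 0"
    using omega_submodule_cases[OF assms, of beta] submodule_R_sub[OF assms, of beta]
      submodule_S_sub[OF assms that] by blast
  show "S_sub g \<subseteq> R_sub g" for g
    by (rule S_sub_subset_R_sub)
  show "free_module_of_rank cpoly_ring (quot_module (omega_L0_module lam beta) (R_sub g)) (2 * degree g)"
    if "g \<noteq> 0" for g
    by (rule free_quotient_R_sub[OF that])
  show "(\<exists>g. degree g = 1 \<and> M = R_sub g) \<or> (coeff beta 0 = 0 \<and> M = S_sub 1)"
    if "omega_maximal_submodule lam beta M" for M
    by (rule maximal_submodule_cases[OF assms that])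
qed (rule R_sub_mono, assumption)+

end
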